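(* Let $G$ be a parametric bilinear system given by matrix functions $\mathcal{C},\mathcal{K},\mathcal{B},\mathcal{N}_1,\dots,\mathcal{N}_m$ with structured subsystem transfer functions $G_k$, and let $\widehat G$ be the reduced-order parametric bilinear system obtained by projection with $V,W\in\mathbb{C}^{n\times r}$, with subsystem transfer functions $\widehat G_k$ (see context). Let $k,\theta\ge 1$, and let the matrix functions $\mathcal{C}(s,\mu)$, $\mathcal{K}(s,\mu)^{-1}$, $\mathcal{N}(s,\mu)$, $\mathcal{B}(s,\mu)$ and $\widehat{\mathcal{K}}(s,\mu)^{-1}$ be defined for given sets of frequency interpolation points $\sigma_1,\dots,\sigma_k\in\mathbb{C}$ and $\varsigma_1,\dots,\varsigma_\theta\in\mathbb{C}$ and the parameter interpolation point $\hat\mu\in\mathbb{M}$. (a) If $V$ is constructed such that $\operatorname{span}(V)\supseteq\operatorname{span}([V_1,\dots,V_k])$, where $$V_1=\mathcal{K}(\sigma_1,\hat\mu)^{-1}\mathcal{B}(\sigma_1,\hat\mu),\qquad V_j=\mathcal{K}(\sigma_j,\hat\mu)^{-1}\mathcal{N}(\sigma_{j-1},\hat\mu)(I_m\otimes V_{j-1}),\quad 2\le j\le k,$$ then $$G_j(\sigma_1,\dots,\sigma_j,\hat\mu)=\widehat G_j(\sigma_1,\dots,\sigma_j,\hat\mu),\qquad j=1,\dots,k.$$ (b) If $W$ is constructed such that $\operatorname{span}(W)\supseteq\operatorname{span}([W_1,\dots,W_\theta])$, where $$W_1=\mathcal{K}(\varsigma_\theta,\hat\mu)^{-\mathsf H}\mathcal{C}(\varsigma_\theta,\hat\mu)^{\mathsf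 H},\qquad W_i=\mathcal{K}(\varsigma_{\theta-i+1},\hat\mu)^{-\mathsf H}\,\widetilde{\mathcal{N}}(\varsigma_{\theta-i+1},\hat\mu)^{\mathsf H}(I_m\otimes W_{i-1}),\quad 2\le i\le\theta,$$ then $$G_i(\varsigma_{\theta-i+1},\dots,\varsigma_\theta,\hat\mu)=\widehat G_i(\varsigma_{\theta-i+1},\dots,\varsigma_\theta,\hat\mu),\qquad i=1,\dots,\theta.$$ (c) Let $V$ be constructed as in (a) and $W$ as in (b). Then, in addition to the interpolation conditions in (a) and (b), $$G_{q+\eta}(\sigma_1,\dots,\sigma_q,\varsigma_{\theta-\eta+1},\dots,\varsigma_\theta,\hat\mu)=\widehat G_{q+\eta}(\sigma_1,\dots,\sigma_q,\varsigma_{\theta-\eta+1},\dots,\varsigma_\theta,\hat\mu)$$ holds for all $1\le q\le k$ and $1\le\eta\le\theta$.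
   Context: Let $n,m,p,d,r$ be positive integers and $\mathbb{M}\subset\mathbb{R}^d$. A (structured) parametric bilinear system $G$ is described by matrix functions $\mathcal{C}:\mathbb{C}\times\mathbb{M}\to\mathbb{C}^{p\times n}$, $\mathcal{K}:\mathbb{C}\times\mathbb{M}\to\mathbb{C}^{n\times n}$, $\mathcal{B}:\mathbb{C}\times\mathbb{M}\to\mathbb{C}^{n\times m}$, $\mathcal{N}_j:\mathbb{C}\times\mathbb{M}\to\mathbb{C}^{n\times n}$ for $j=1,\dots,m$. Put $\mathcal{N}(s,\mu)=[\mathcal{N}_1(s,\mu),\dots,\mathcal{N}_m(s,\mu)]\in\mathbb{C}^{n\times nm}$ (horizontal concatenation) and let $\widetilde{\mathcal{N}}(s,\mu)\in\mathbb{C}^{nm\times n}$ be the vertical concatenation of $\mathcal{N}_1(s,\mu),\dots,\mathcal{N}_m(s,\mu)$. For $k\ge1$ the $k$-th structured subsystem transfer function is $$G_k(s_1,\dots,s_k,\mu)=\mathcal{C}(s_k,\mu)\mathcal{K}(s_k,\mu)^{-1}\left(\prod_{j=1}^{k-1}(I_{m^{j-1}}\otimes\mathcal{N}(s_{k-j},\mu))(I_{m^j}\otimes\mathcal{K}(s_{k-j},\mu)^{-1})\right)(I_{m^{k-1}}\otimes\mathcal{B}(s_1,\mu)),$$ where matrix products $\prod_{j=1}^{k-1}$ are ordered from left to right with increasing $j$, an empty product is the identity, $I_\ell$ is the $\ell\times\ell$ identity and $\otimes$ is the Kronecker product. Given $V,W\in\mathbb{C}^{n\times r}$, the reduced-order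 system $\widehat G$ is given by $\widehat{\mathcal{C}}(s,\mu)=\mathcal{C}(s,\mu)V$, $\widehat{\mathcal{K}}(s,\mu)=W^{\mathsf H}\mathcal{K}(s,\mu)V$, $\widehat{\mathcal{B}}(s,\mu)=W^{\mathsf H}\mathcal{B}(s,\mu)$, $\widehat{\mathcal{N}}_j(s,\mu)=W^{\mathsf H}\mathcal{N}_j(s,\mu)V$, $\widehat{\mathcal{N}}=[\widehat{\mathcal{N}}_1,\dots,\widehat{\mathcal{N}}_m]$, and $\widehat G_k$ is defined by the same formula as $G_k$ with all matrix functions replaced by their hatted versions. $\operatorname{span}(X)$ denotes the column space of a matrix $X$; $X^{\mathsf H}$ is the conjugate transpose and $X^{-\mathsf H}=(X^{-1})^{\mathsf H}$. That the inverses are "defined" at the interpolation points means that the matrices $\mathcal{K}(s,\hat\mu)$ and $\widehat{\mathcal{K}}(s,\hat\mu)$ are invertible for $s$ any of the given frequency points. *)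

theory Defs
  imports
    "Jordan_Normal_Form.Schur_Decomposition"
    "Jordan_Normal_Form.VS_Connect"
    "Jordan_Normal_Form.Gauss_Jordan_Elimination"
begin

text \<open>Matrices have run-time dimensions here because the identities in the transfer functions
  have sizes \<open>m ^ j\<close> that vary with the summation index. Conjugate transposition is
  \<^const>\<open>mat_adjoint\<close>.\<close>

text \<open>The inverse of an invertible matrix; meaningless for other arguments.\<close>

definition minv :: "complex mat \<Rightarrow> complex mat" where
  "minv A = the (mat_inverse A)"

definition kron :: "complex mat \<Rightarrow> complex mat \<Rightarrow> complex mat"  (infixl \<open>\<otimes>\<^sub>K\<close> 75) where
  "A \<otimes>\<^sub>K B = mat (dim_row A * dim_row B) (dim_col A * dim_col B)
     (\<lambda>(i, j). A $$ (i div dim_row B, j div dim_col B) * B $$ (i mod dim_row B, j mod dim_col B))"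

text \<open>Concatenations of blocks with \<open>n\<close> rows, respectively \<open>n\<close> columns.\<close>

definition hconcat :: "nat \<Rightarrow> complex mat list \<Rightarrow> complex mat" where
  "hconcat n As = mat_of_cols n (concat (map cols As))"

definition vconcat :: "nat \<Rightarrow> complex mat list \<Rightarrow> complex mat" where
  "vconcat n As = mat_of_rows n (concat (map rows As))"

text \<open>Left-to-right product of a list of matrices; \<open>n\<close> is the number of rows, which fixes the size
  of the empty product.\<close>

definition mprod :: "nat \<Rightarrow> complex mat list \<Rightarrow> complex mat" where
  "mprod n As = foldl (*) (1\<^sub>m n) As"

record bilinear_system =
  Cf :: "complex \<Rightarrow> real vec \<Rightarrow> complex mat"
  Kf :: "complex \<Rightarrow> real vec \<Rightarrow> complex mat"
  Bf :: "complex \<Rightarrow> real vec \<Rightarrow> complex mat"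
  Nf :: "nat \<Rightarrow> complex \<Rightarrow> real vec \<Rightarrow> complex mat"

text \<open>\<open>n\<close>, \<open>m\<close>, \<open>p\<close> are the numbers of states, inputs and outputs; the bilinear terms \<open>Nf G j\<close> are
  indexed by \<open>1 \<le> j \<le> m\<close>.\<close>

definition parametric_bilinear_system ::
    "nat \<Rightarrow> nat \<Rightarrow> nat \<Rightarrow> real vec set \<Rightarrow> bilinear_system \<Rightarrow> bool" where
  "parametric_bilinear_system n m p M G \<longleftrightarrow>
     (\<forall>s. \<forall>\<mu>\<in>M. Cf G s \<mu> \<in> carrier_mat p n \<and> Kf G s \<mu> \<in> carrier_mat n n \<and>
        Bf G s \<mu> \<in> carrier_mat n m \<and> (\<forall>j\<in>{1..m}. Nf G j s \<mu> \<in> carrier_mat n n))"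

definition N_row :: "nat \<Rightarrow> nat \<Rightarrow> bilinear_system \<Rightarrow> complex \<Rightarrow> real vec \<Rightarrow> complex mat" where
  "N_row n m G s \<mu> = hconcat n (map (\<lambda>j. Nf G j s \<mu>) [1..<Suc m])"

definition N_col :: "nat \<Rightarrow> nat \<Rightarrow> bilinear_system \<Rightarrow> complex \<Rightarrow> real vec \<Rightarrow> complex mat" where
  "N_col n m G s \<mu> = vconcat n (map (\<lambda>j. Nf G j s \<mu>) [1..<Suc m])"

text \<open>The subsystem level \<open>k\<close> is the length of the list \<open>ss = [s\<^sub>1, \<dots>, s\<^sub>k]\<close> of frequencies.\<close>

definition transfer ::
    "nat \<Rightarrow> nat \<Rightarrow> bilinear_system \<Rightarrow> complex list \<Rightarrow> real vec \<Rightarrow> complex mat" where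
  "transfer n m G ss \<mu> =
     (let k = length ss; s = (\<lambda>j. ss ! (j - 1)) in
        Cf G (s k) \<mu> * minv (Kf G (s k) \<mu>)
        * mprod n (map (\<lambda>j. (1\<^sub>m (m ^ (j - 1)) \<otimes>\<^sub>K N_row n m G (s (k - j)) \<mu>)
                          * (1\<^sub>m (m ^ j) \<otimes>\<^sub>K minv (Kf G (s (k - j)) \<mu>))) [1..<k])
        * (1\<^sub>m (m ^ (k - 1)) \<otimes>\<^sub>K Bf G (s 1) \<mu>))"

definition reduced_system ::
    "complex mat \<Rightarrow> complex mat \<Rightarrow> bilinear_system \<Rightarrow> bilinear_system" where
  "reduced_system V W G =
     \<lparr> Cf = (\<lambda>s \<mu>. Cf G s \<mu> * V),
       Kf = (\<lambda>s \<mu>. mat_adjoint W * Kf G s \<mu> * V),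
       Bf = (\<lambda>s \<mu>. mat_adjoint W * Bf G s \<mu>),
       Nf = (\<lambda>j s \<mu>. mat_adjoint W * Nf G j s \<mu> * V) \<rparr>"

abbreviation column_space :: "nat \<Rightarrow> complex mat \<Rightarrow> complex vec set" where
  "column_space n A \<equiv> vec_space.col_space n A"

text \<open>The blocks \<open>V\<^sub>j\<close> and \<open>W\<^sub>i\<close> are indexed from 1; index 0 is never used.\<close>

fun V_block ::
    "nat \<Rightarrow> nat \<Rightarrow> bilinear_system \<Rightarrow> (nat \<Rightarrow> complex) \<Rightarrow> real vec \<Rightarrow> nat \<Rightarrow> complex mat" where
  "V_block n m G \<sigma> \<mu> 0 = 0\<^sub>m n 0"
| "V_block n m G \<sigma> \<mu> (Suc 0) = minv (Kf G (\<sigma> 1) \<mu>) * Bf G (\<sigma> 1) \<mu>"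
| "V_block n m G \<sigma> \<mu> (Suc (Suc j)) =
     minv (Kf G (\<sigma> (Suc (Suc j))) \<mu>) * N_row n m G (\<sigma> (Suc j)) \<mu>
     * (1\<^sub>m m \<otimes>\<^sub>K V_block n m G \<sigma> \<mu> (Suc j))"

fun W_block ::
    "nat \<Rightarrow> nat \<Rightarrow> bilinear_system \<Rightarrow> nat \<Rightarrow> (nat \<Rightarrow> complex) \<Rightarrow> real vec \<Rightarrow> nat \<Rightarrow> complex mat" where
  "W_block n m G \<theta> \<tau> \<mu> 0 = 0\<^sub>m n 0"
| "W_block n m G \<theta> \<tau> \<mu> (Suc 0) =
     mat_adjoint (minv (Kf G (\<tau> \<theta>) \<mu>)) * mat_adjoint (Cf G (\<tau> \<theta>) \<mu>)"
| "W_block n m G \<theta> \<tau> \<mu> (Suc (Suc i)) =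
     mat_adjoint (minv (Kf G (\<tau> (\<theta> - Suc (Suc i) + 1)) \<mu>))
     * mat_adjoint (N_col n m G (\<tau> (\<theta> - Suc (Suc i) + 1)) \<mu>)
     * (1\<^sub>m m \<otimes>\<^sub>K W_block n m G \<theta> \<tau> \<mu> (Suc i))"

end

theory Submission
  imports Defs
begin

text \<open>Absorbing the subsystems one after the other into the input matrix, starting with
  \<open>s\<^sub>1\<close>, turns \<open>G\<^sub>k(s\<^sub>1, \<dots>, s\<^sub>k)\<close> into a recursive cascade applied to \<open>B(s\<^sub>1)\<close>.
  After \<open>\<sigma>\<^sub>1, \<dots>, \<sigma>\<^sub>q\<close> its state is \<open>V\<^sub>q\<close>; as the columns of \<open>V\<^sub>q\<close> lie in the range of \<open>V\<close>, the
  Galerkin condition makes the reduced state a solution of the full equation, so \<open>V\<close> lifts it to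
  \<open>V\<^sub>q\<close>. Dually, the last \<open>i\<close> stages see their input \<open>X\<close> only through \<open>W\<^sub>i\<^sup>H X\<close>. When the columns of \<open>W\<^sub>i\<close> lie
  in the range of \<open>W\<close>, replacing \<open>X\<close> by \<open>K V Y\<close>, with \<open>Y\<close> the reduced state for \<open>W\<^sup>H X\<close>, does not change this
  quantity, which lets one pass to the reduced cascade stage by stage. Part (c) feeds the
  input produced by the \<open>\<sigma>\<close>-stages into the \<open>\<tau>\<close>-stages.\<close>

section \<open>Block matrices\<close>

text \<open>A row or column of \<open>1\<^sub>m a \<otimes>\<^sub>K A\<close> vanishes outside one
  block. Writing \<open>l = t * c + u\<close> restricts a sum over all indices to that block;
  products with such a factor are evaluated entrywise through this.\<close>

lemma sum_block:
  fixes g :: "nat \<Rightarrow> 'a::comm_monoid_add"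
  assumes "t < a"
  shows "(\<Sum>l<a * c. if l div c = t then g (l mod c) else 0) = (\<Sum>u<c. g u)"
proof (cases "c = 0")
  case False
  then have c: "c > 0" by simp
  have img: "{l \<in> {..<a * c}. l div c = t} = (\<lambda>u. t * c + u) ` {..<c}"
  proof (intro equalityI subsetI)
    fix l assume "l \<in> {l \<in> {..<a * c}. l div c = t}"
    then have "l = t * c + l mod c" "l mod c < c" using c by auto
    then show "l \<in> (\<lambda>u. t * c + u) ` {..<c}" by blast
  next
    fix l assume "l \<in> (\<lambda>u. t * c + u) ` {..<c}"
    then obtain u where u: "u < c" "l = t * c + u" by auto
    have "t * c + u < Suc t * c" using u by simp
    also have "\<dots> \<le> a * c" using assms by (intro mult_right_mono) auto
    finally show "l \<in> {l \<in> {..<a * c}. l div c = t}" using u by simp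
  qed
  have "(\<Sum>l<a * c. if l div c = t then g (l mod c) else 0)
      = (\<Sum>l\<in>{l \<in> {..<a * c}. l div c = t}. g (l mod c))"
    by (rule sum.inter_filter[symmetric]) simp
  also have "\<dots> = (\<Sum>u<c. g ((t * c + u) mod c))"
    unfolding img by (subst sum.reindex) (auto simp: inj_on_def)
  also have "\<dots> = (\<Sum>u<c. g u)" by (rule sum.cong) auto
  finally show ?thesis .
qed simp

lemma length_concat_uniform:
  "\<forall>x\<in>set xs. length x = c \<Longrightarrow> length (concat xs) = length xs * c"
  by (induction xs) auto

lemma nth_concat_uniform:
  assumes "\<forall>x\<in>set xs. length x = c" "j < length xs * c"
  shows "concat xs ! j = xs ! (j div c) ! (j mod c)"
  using assms
proof (induction xs arbitrary: j)
  case (Cons x xs)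
  then have c: "c > 0" by (cases c) auto
  show ?case
  proof (cases "j < c")
    case True
    then show ?thesis using Cons by (simp add: nth_append)
  next
    case False
    moreover have "concat xs ! (j - c) = xs ! ((j - c) div c) ! ((j - c) mod c)"
      using Cons False by (intro Cons.IH) auto
    moreover have "j div c = Suc ((j - c) div c)" using False c by (simp add: le_div_geq)
    moreover have "j mod c = (j - c) mod c" using False by (simp add: le_mod_geq)
    ultimately show ?thesis using Cons.prems by (simp add: nth_append)
  qed
qed simp

lemma div_less_mult: "i < a * c \<Longrightarrow> i div c < a" for i a c :: nat
  by (simp add: less_mult_imp_div_less)

lemma mod_less_mult: "i < a * c \<Longrightarrow> i mod c < c" for i a c :: nat
  by (cases "c = 0") auto

lemma kron_one_carrier [simp]:
  "A \<in> carrier_mat nr nc \<Longrightarrow> 1\<^sub>m a \<otimes>\<^sub>K A \<in> carrier_mat (a * nr) (a * nc)"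
  by (auto simp: kron_def)

lemma kron_one_index:
  assumes "A \<in> carrier_mat nr nc" "i < a * nr" "j < a * nc"
  shows "(1\<^sub>m a \<otimes>\<^sub>K A) $$ (i, j) = (if i div nr = j div nc then A $$ (i mod nr, j mod nc) else 0)"
  using assms div_less_mult[OF assms(2)] div_less_mult[OF assms(3)] by (auto simp: kron_def)

text \<open>The mixed-product rule for an identity as left factor: block diagonal matrices multiply
  block by block.\<close>

lemma kron_one_mult:
  assumes A: "A \<in> carrier_mat nr nc" and B: "B \<in> carrier_mat nc nd"
  shows "1\<^sub>m a \<otimes>\<^sub>K (A * B) = (1\<^sub>m a \<otimes>\<^sub>K A) * (1\<^sub>m a \<otimes>\<^sub>K B)"
proof (rule eq_matI)
  have kA: "1\<^sub>m a \<otimes>\<^sub>K A \<in> carrier_mat (a * nr) (a * nc)" using A by simp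
  have kB: "1\<^sub>m a \<otimes>\<^sub>K B \<in> carrier_mat (a * nc) (a * nd)" using B by simp
  have kAB: "1\<^sub>m a \<otimes>\<^sub>K (A * B) \<in> carrier_mat (a * nr) (a * nd)" using A B by simp
  show "dim_row (1\<^sub>m a \<otimes>\<^sub>K (A * B)) = dim_row ((1\<^sub>m a \<otimes>\<^sub>K A) * (1\<^sub>m a \<otimes>\<^sub>K B))"
    "dim_col (1\<^sub>m a \<otimes>\<^sub>K (A * B)) = dim_col ((1\<^sub>m a \<otimes>\<^sub>K A) * (1\<^sub>m a \<otimes>\<^sub>K B))"
    using kA kB kAB by auto
  fix i j
  assume "i < dim_row ((1\<^sub>m a \<otimes>\<^sub>K A) * (1\<^sub>m a \<otimes>\<^sub>K B))" "j < dim_col ((1\<^sub>m a \<otimes>\<^sub>K A) * (1\<^sub>m a \<otimes>\<^sub>K B))"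
  then have i: "i < a * nr" and j: "j < a * nd" using kA kB by auto
  note ij = div_less_mult[OF i] div_less_mult[OF j] mod_less_mult[OF i] mod_less_mult[OF j]
  have "((1\<^sub>m a \<otimes>\<^sub>K A) * (1\<^sub>m a \<otimes>\<^sub>K B)) $$ (i, j)
      = (\<Sum>l<a * nc. (1\<^sub>m a \<otimes>\<^sub>K A) $$ (i, l) * (1\<^sub>m a \<otimes>\<^sub>K B) $$ (l, j))"
    using i j kA kB by (auto simp: scalar_prod_def atLeast0LessThan)
  \<comment> \<open>The condition \<open>l div nc = j div nd\<close> of the second factor becomes
    \<open>i div nr = j div nd\<close>, which no longer involves \<open>l\<close>, so that
    \<open>sum_block\<close> applies.\<close>
  also have "\<dots> = (\<Sum>l<a * nc. if l div nc = i div nr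
      then (if i div nr = j div nd then A $$ (i mod nr, l mod nc) * B $$ (l mod nc, j mod nd) else 0) else 0)"
    using i j by (intro sum.cong) (auto simp: kron_one_index[OF A] kron_one_index[OF B])
  also have "\<dots> = (\<Sum>u<nc. if i div nr = j div nd then A $$ (i mod nr, u) * B $$ (u, j mod nd) else 0)"
    by (rule sum_block[OF ij(1)])
  also have "\<dots> = (1\<^sub>m a \<otimes>\<^sub>K (A * B)) $$ (i, j)"
    using i j ij A B
    by (subst kron_one_index[where nr = nr and nc = nd])
      (auto simp: scalar_prod_def atLeast0LessThan)
  finally show "(1\<^sub>m a \<otimes>\<^sub>K (A * B)) $$ (i, j) = ((1\<^sub>m a \<otimes>\<^sub>K A) * (1\<^sub>m a \<otimes>\<^sub>K B)) $$ (i, j)" ..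
qed

text \<open>Quotient and remainder by \<open>b\<close> split an index of the large identity into one
  index for each nested identity. This merges the \<open>1\<^sub>m m\<close> contributed by each
  stage into powers of \<open>m\<close>.\<close>

lemma kron_one_kron_one:
  assumes A: "A \<in> carrier_mat nr nc"
  shows "1\<^sub>m a \<otimes>\<^sub>K (1\<^sub>m b \<otimes>\<^sub>K A) = 1\<^sub>m (a * b) \<otimes>\<^sub>K A"
proof (rule eq_matI)
  have kA: "1\<^sub>m b \<otimes>\<^sub>K A \<in> carrier_mat (b * nr) (b * nc)" using A by simp
  have k1: "1\<^sub>m a \<otimes>\<^sub>K (1\<^sub>m b \<otimes>\<^sub>K A) \<in> carrier_mat (a * (b * nr)) (a * (b * nc))" using kA by simp
  have k2: "1\<^sub>m (a * b) \<otimes>\<^sub>K A \<in> carrier_mat (a * b * nr) (a * b * nc)" using A by simp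
  show "dim_row (1\<^sub>m a \<otimes>\<^sub>K (1\<^sub>m b \<otimes>\<^sub>K A)) = dim_row (1\<^sub>m (a * b) \<otimes>\<^sub>K A)"
    "dim_col (1\<^sub>m a \<otimes>\<^sub>K (1\<^sub>m b \<otimes>\<^sub>K A)) = dim_col (1\<^sub>m (a * b) \<otimes>\<^sub>K A)"
    using k1 k2 by auto
  fix i j assume "i < dim_row (1\<^sub>m (a * b) \<otimes>\<^sub>K A)" "j < dim_col (1\<^sub>m (a * b) \<otimes>\<^sub>K A)"
  then have i: "i < a * b * nr" and j: "j < a * b * nc" using k2 by auto
  then have i': "i < a * (b * nr)" and j': "j < a * (b * nc)" by (simp_all add: mult.assoc)
  have mod_mult: "x mod (b * c) div c = x div c mod b" "x mod (b * c) mod c = x mod c"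
    "x div (b * c) = x div c div b" if "x < a * b * c" for x c
    using mod_less_mult[OF that] by (auto simp: mult.commute[of b] mod_mult2_eq div_mult2_eq)
  have eq: "(i div nr div b = j div nc div b \<and> i div nr mod b = j div nc mod b)
      = (i div nr = j div nc)"
    by (metis div_mult_mod_eq)
  show "(1\<^sub>m a \<otimes>\<^sub>K (1\<^sub>m b \<otimes>\<^sub>K A)) $$ (i, j) = (1\<^sub>m (a * b) \<otimes>\<^sub>K A) $$ (i, j)"
    using mod_less_mult[OF i'] mod_less_mult[OF j']
    by (simp add: kron_one_index[OF A] kron_one_index[OF kA] i j i' j' mod_mult flip: eq)
qed

section \<open>Conjugate transposes, inverses and column spaces\<close>

lemma adjoint_carrier [simp]: "A \<in> carrier_mat nr nc \<Longrightarrow> mat_adjoint A \<in> carrier_mat nc nr"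
  by (auto simp: mat_adjoint_def)

lemma adjoint_index:
  fixes A :: "complex mat"
  shows "i < dim_col A \<Longrightarrow> j < dim_row A \<Longrightarrow> mat_adjoint A $$ (i, j) = cnj (A $$ (j, i))"
  by (simp add: mat_adjoint_def mat_of_rows_index)

lemma adjoint_dim [simp]:
  "dim_row (mat_adjoint A) = dim_col A" "dim_col (mat_adjoint A) = dim_row A"
  by (simp_all add: mat_adjoint_def)

lemma adjoint_adjoint [simp]: "mat_adjoint (mat_adjoint A) = A" for A :: "complex mat"
  by (rule eq_matI) (auto simp: adjoint_index)

lemma adjoint_mult:
  fixes A B :: "complex mat"
  assumes "A \<in> carrier_mat nr nc" "B \<in> carrier_mat nc nd"
  shows "mat_adjoint (A * B) = mat_adjoint B * mat_adjoint A"
  using assms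
  by (intro eq_matI) (auto simp: adjoint_index scalar_prod_def mult.commute intro!: sum.cong)

lemma adjoint_kron_one: "mat_adjoint (1\<^sub>m a \<otimes>\<^sub>K A) = 1\<^sub>m a \<otimes>\<^sub>K mat_adjoint A"
proof (rule eq_matI)
  have A: "A \<in> carrier_mat (dim_row A) (dim_col A)" by simp
  have A': "mat_adjoint A \<in> carrier_mat (dim_col A) (dim_row A)" by simp
  note k1 = kron_one_carrier[OF A, of a] and k2 = kron_one_carrier[OF A', of a]
  show "dim_row (mat_adjoint (1\<^sub>m a \<otimes>\<^sub>K A)) = dim_row (1\<^sub>m a \<otimes>\<^sub>K mat_adjoint A)"
    "dim_col (mat_adjoint (1\<^sub>m a \<otimes>\<^sub>K A)) = dim_col (1\<^sub>m a \<otimes>\<^sub>K mat_adjoint A)"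
    unfolding adjoint_dim using carrier_matD[OF k1] carrier_matD[OF k2] by simp_all
  fix i j assume "i < dim_row (1\<^sub>m a \<otimes>\<^sub>K mat_adjoint A)" "j < dim_col (1\<^sub>m a \<otimes>\<^sub>K mat_adjoint A)"
  then have i: "i < a * dim_col A" and j: "j < a * dim_row A" using k2 by auto
  show "mat_adjoint (1\<^sub>m a \<otimes>\<^sub>K A) $$ (i, j) = (1\<^sub>m a \<otimes>\<^sub>K mat_adjoint A) $$ (i, j)"
    using carrier_matD[OF k1] mod_less_mult[OF i] mod_less_mult[OF j]
    by (auto simp: kron_one_index[OF A'] i j adjoint_index kron_one_index[OF A])
qed

text \<open>As \<open>minv\<close> applies \<open>the\<close> to an option,
  \<open>mat_inverse\<close> has to be shown to succeed; it does so on the units of the matrix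
  ring.\<close>

lemma
  assumes A: "A \<in> carrier_mat n n" and inv: "invertible_mat A"
  shows minv_carrier: "minv A \<in> carrier_mat n n"
    and minv_left: "minv A * A = 1\<^sub>m n"
    and minv_right: "A * minv A = 1\<^sub>m n"
proof -
  obtain B where B: "A * B = 1\<^sub>m n" "B * A = 1\<^sub>m (dim_row B)"
    using inv A unfolding invertible_mat_def inverts_mat_def by auto
  \<comment> \<open>\<open>invertible_mat\<close> does not state the dimensions of \<open>B\<close>;
    comparing column counts in the two identities yields them.\<close>
  have "dim_col B = n" using arg_cong[OF B(1), of dim_col] by simp
  moreover have "dim_row B = n" using arg_cong[OF B(2), of dim_col] A by simp
  ultimately have "A \<in> Units (ring_mat TYPE(complex) n ())"
    using A B unfolding Units_def ring_mat_def by auto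
  then obtain B' where "mat_inverse A = Some B'"
    using mat_inverse(1)[OF A, of "()"] by (cases "mat_inverse A") auto
  then show "minv A \<in> carrier_mat n n" "minv A * A = 1\<^sub>m n" "A * minv A = 1\<^sub>m n"
    using mat_inverse(2)[OF A] by (auto simp: minv_def)
qed

text \<open>Each column of a block lies in the spanned space and so has a coefficient vector with
  respect to the columns of \<open>V\<close>; these vectors are the columns of \<open>X\<close>. The
  span conditions enter later only as such factorizations.\<close>

lemma col_space_subset_factor:
  assumes sub: "column_space n (hconcat n As) \<subseteq> column_space n V"
    and dims: "\<forall>A\<in>set As. dim_row A = n" and B: "B \<in> set As" and V: "V \<in> carrier_mat n r"
  obtains X where "X \<in> carrier_mat r (dim_col B)" "B = V * X"
proof -
  interpret vec_space "TYPE(complex)" n .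
  have cols: "set (concat (map cols As)) \<subseteq> carrier_vec n"
    using dims by (auto dest: subsetD[OF cols_dim])
  have Bn: "dim_row B = n" using dims B by auto
  have "\<exists>x\<in>carrier_vec r. V *\<^sub>v x = col B j" if j: "j < dim_col B" for j
  proof -
    have "col B j \<in> set (cols B)" using j by (auto simp: cols_def)
    then have "col B j \<in> set (concat (map cols As))" using B by auto
    then have "col B j \<in> column_space n (hconcat n As)"
      unfolding col_space_def hconcat_def cols_mat_of_cols[OF cols]
      using in_own_span[OF cols] by auto
    then show ?thesis using sub V col_space_eq[OF V] by auto
  qed
  then obtain x where x: "\<And>j. j < dim_col B \<Longrightarrow> x j \<in> carrier_vec r \<and> V *\<^sub>v x j = col B j"
    by metis
  let ?X = "mat_of_cols r (map x [0..<dim_col B])"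
  have "B = V * ?X"
  proof (rule eq_matI)
    fix i j assume "i < dim_row (V * ?X)" "j < dim_col (V * ?X)"
    then have i: "i < n" and j: "j < dim_col B" using V by auto
    have "col ?X j = x j" using j x by (subst col_mat_of_cols) auto
    then have "(V * ?X) $$ (i, j) = (V *\<^sub>v x j) $ i" using i j V by auto
    also have "V *\<^sub>v x j = col B j" using x[OF j] by blast
    also have "col B j $ i = B $$ (i, j)" using i j Bn by simp
    finally show "B $$ (i, j) = (V * ?X) $$ (i, j)" ..
  qed (use V Bn in auto)
  then show ?thesis by (intro that[of ?X]) auto
qed

section \<open>Cascades of subsystems\<close>

text \<open>Invertibility is available only at the interpolation points, so the conditions are
  collected for a single frequency. With \<open>n\<close> as an argument the predicate serves the
  full system and, with \<open>r\<close> in its place, the reduced one.\<close>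

definition regular_at :: "nat \<Rightarrow> nat \<Rightarrow> nat \<Rightarrow> bilinear_system \<Rightarrow> real vec \<Rightarrow> complex \<Rightarrow> bool" where
  "regular_at n m p G \<mu> s \<longleftrightarrow>
     Cf G s \<mu> \<in> carrier_mat p n \<and> Kf G s \<mu> \<in> carrier_mat n n \<and> invertible_mat (Kf G s \<mu>)
     \<and> Bf G s \<mu> \<in> carrier_mat n m \<and> (\<forall>j\<in>{1..m}. Nf G j s \<mu> \<in> carrier_mat n n)"

text \<open>Bilinear terms are counted from 1, blocks from 0; the fourth clause is shifted so that
  block numbers obtained by \<open>div\<close> fit.\<close>

lemma regular_atD:
  assumes "regular_at n m p G \<mu> s"
  shows "Cf G s \<mu> \<in> carrier_mat p n" "Kf G s \<mu> \<in> carrier_mat n n" "Bf G s \<mu> \<in> carrier_mat n m"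
    "j < m \<Longrightarrow> Nf G (Suc j) s \<mu> \<in> carrier_mat n n"
    "minv (Kf G s \<mu>) \<in> carrier_mat n n"
    "minv (Kf G s \<mu>) * Kf G s \<mu> = 1\<^sub>m n" "Kf G s \<mu> * minv (Kf G s \<mu>) = 1\<^sub>m n"
  using assms minv_carrier minv_left minv_right unfolding regular_at_def by auto

section \<open>Block rows and block columns of the bilinear terms\<close>

lemma N_row_carrier:
  assumes "regular_at n m p G \<mu> s"
  shows "N_row n m G s \<mu> \<in> carrier_mat n (m * n)"
proof -
  have "\<forall>x\<in>set (map cols (map (\<lambda>j. Nf G j s \<mu>) [1..<Suc m])). length x = n"
    using assms unfolding regular_at_def by auto
  then have "length (concat (map cols (map (\<lambda>j. Nf G j s \<mu>) [1..<Suc m]))) = m * n"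
    by (subst length_concat_uniform) (auto simp del: upt_Suc)
  then show ?thesis unfolding N_row_def hconcat_def by (metis mat_of_cols_carrier(1))
qed

lemma N_row_index:
  assumes reg: "regular_at n m p G \<mu> s" and i: "i < n" and j: "j < m * n"
  shows "N_row n m G s \<mu> $$ (i, j) = Nf G (Suc (j div n)) s \<mu> $$ (i, j mod n)"
proof -
  let ?xs = "map cols (map (\<lambda>j. Nf G j s \<mu>) [1..<Suc m])"
  have unif: "\<forall>x\<in>set ?xs. length x = n"
    using reg unfolding regular_at_def by auto
  note jd = div_less_mult[OF j] mod_less_mult[OF j]
  have N: "Nf G (Suc (j div n)) s \<mu> \<in> carrier_mat n n" using regular_atD(4)[OF reg jd(1)] .
  have len: "length (concat ?xs) = m * n"
    using N_row_carrier[OF reg] unfolding N_row_def hconcat_def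
    by (metis carrier_matD(2) mat_of_cols_carrier(3))
  have "concat ?xs ! j = ?xs ! (j div n) ! (j mod n)"
    using j by (intro nth_concat_uniform unif) (simp del: upt_Suc)
  also have "?xs ! (j div n) = cols (Nf G (Suc (j div n)) s \<mu>)"
    using jd by (simp del: upt_Suc)
  also have "cols (Nf G (Suc (j div n)) s \<mu>) ! (j mod n) = col (Nf G (Suc (j div n)) s \<mu>) (j mod n)"
    using N jd by simp
  finally show ?thesis
    unfolding N_row_def hconcat_def using i j len jd N by (subst mat_of_cols_index) auto
qed

lemma N_col_carrier:
  assumes "regular_at n m p G \<mu> s"
  shows "N_col n m G s \<mu> \<in> carrier_mat (m * n) n"
proof -
  have "\<forall>x\<in>set (map rows (map (\<lambda>j. Nf G j s \<mu>) [1..<Suc m])). length x = n"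
    using assms unfolding regular_at_def by auto
  then have "length (concat (map rows (map (\<lambda>j. Nf G j s \<mu>) [1..<Suc m]))) = m * n"
    by (subst length_concat_uniform) (auto simp del: upt_Suc)
  then show ?thesis unfolding N_col_def vconcat_def by (metis mat_of_rows_carrier(1))
qed

lemma N_col_index:
  assumes reg: "regular_at n m p G \<mu> s" and i: "i < m * n" and j: "j < n"
  shows "N_col n m G s \<mu> $$ (i, j) = Nf G (Suc (i div n)) s \<mu> $$ (i mod n, j)"
proof -
  let ?xs = "map rows (map (\<lambda>j. Nf G j s \<mu>) [1..<Suc m])"
  have unif: "\<forall>x\<in>set ?xs. length x = n"
    using reg unfolding regular_at_def by auto
  note jd = div_less_mult[OF i] mod_less_mult[OF i]
  have N: "Nf G (Suc (i div n)) s \<mu> \<in> carrier_mat n n" using regular_atD(4)[OF reg jd(1)] .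
  have len: "length (concat ?xs) = m * n"
    using N_col_carrier[OF reg] unfolding N_col_def vconcat_def
    by (metis carrier_matD(1) mat_of_rows_carrier(2))
  have "concat ?xs ! i = ?xs ! (i div n) ! (i mod n)"
    using i by (intro nth_concat_uniform unif) (simp del: upt_Suc)
  also have "?xs ! (i div n) = rows (Nf G (Suc (i div n)) s \<mu>)"
    using jd by (simp del: upt_Suc)
  also have "rows (Nf G (Suc (i div n)) s \<mu>) ! (i mod n) = row (Nf G (Suc (i div n)) s \<mu>) (i mod n)"
    using N jd by simp
  finally show ?thesis
    unfolding N_col_def vconcat_def using i j len jd N by (subst mat_of_rows_index) auto
qed

text \<open>The right factor is block diagonal, so the product is the block row with blocks
  \<open>N\<^sub>t * Y\<close>, each \<open>c\<close> columns wide.\<close>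

lemma col_N_row_mult_kron:
  assumes reg: "regular_at n m p G \<mu> s" and Y: "Y \<in> carrier_mat n c" and j: "j < m * c"
  shows "col (N_row n m G s \<mu> * (1\<^sub>m m \<otimes>\<^sub>K Y)) j = col (Nf G (Suc (j div c)) s \<mu> * Y) (j mod c)"
proof (rule eq_vecI)
  note jd = div_less_mult[OF j] mod_less_mult[OF j]
  note N = regular_atD(4)[OF reg jd(1)] and Nr = N_row_carrier[OF reg]
  have k: "1\<^sub>m m \<otimes>\<^sub>K Y \<in> carrier_mat (m * n) (m * c)" using Y by simp
  show "dim_vec (col (N_row n m G s \<mu> * (1\<^sub>m m \<otimes>\<^sub>K Y)) j)
      = dim_vec (col (Nf G (Suc (j div c)) s \<mu> * Y) (j mod c))"
    using N Nr by simp
  fix i assume "i < dim_vec (col (Nf G (Suc (j div c)) s \<mu> * Y) (j mod c))"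
  then have i: "i < n" using N by simp
  have "col (N_row n m G s \<mu> * (1\<^sub>m m \<otimes>\<^sub>K Y)) j $ i
      = (\<Sum>l<m * n. N_row n m G s \<mu> $$ (i, l) * (1\<^sub>m m \<otimes>\<^sub>K Y) $$ (l, j))"
    using i j Nr k by (auto simp: scalar_prod_def atLeast0LessThan)
  also have "\<dots> = (\<Sum>l<m * n. if l div n = j div c
      then Nf G (Suc (j div c)) s \<mu> $$ (i, l mod n) * Y $$ (l mod n, j mod c) else 0)"
    using i j by (intro sum.cong) (auto simp: kron_one_index[OF Y] N_row_index[OF reg])
  also have "\<dots> = (\<Sum>u<n. Nf G (Suc (j div c)) s \<mu> $$ (i, u) * Y $$ (u, j mod c))"
    by (rule sum_block[OF jd(1)])
  also have "\<dots> = col (Nf G (Suc (j div c)) s \<mu> * Y) (j mod c) $ i"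
    using i jd N Y by (auto simp: scalar_prod_def atLeast0LessThan)
  finally show "col (N_row n m G s \<mu> * (1\<^sub>m m \<otimes>\<^sub>K Y)) j $ i
      = col (Nf G (Suc (j div c)) s \<mu> * Y) (j mod c) $ i" .
qed

text \<open>Dually, the product is the block column with blocks \<open>A * N\<^sub>t\<close>, each
  \<open>a\<close> rows high.\<close>

lemma row_kron_mult_N_col:
  assumes reg: "regular_at n m p G \<mu> s" and A: "A \<in> carrier_mat a n" and i: "i < m * a"
  shows "row ((1\<^sub>m m \<otimes>\<^sub>K A) * N_col n m G s \<mu>) i = row (A * Nf G (Suc (i div a)) s \<mu>) (i mod a)"
proof (rule eq_vecI)
  note jd = div_less_mult[OF i] mod_less_mult[OF i]
  note N = regular_atD(4)[OF reg jd(1)] and Nr = N_col_carrier[OF reg]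
  have k: "1\<^sub>m m \<otimes>\<^sub>K A \<in> carrier_mat (m * a) (m * n)" using A by simp
  show "dim_vec (row ((1\<^sub>m m \<otimes>\<^sub>K A) * N_col n m G s \<mu>) i)
      = dim_vec (row (A * Nf G (Suc (i div a)) s \<mu>) (i mod a))"
    using N Nr by simp
  fix j assume "j < dim_vec (row (A * Nf G (Suc (i div a)) s \<mu>) (i mod a))"
  then have j: "j < n" using N by simp
  have "row ((1\<^sub>m m \<otimes>\<^sub>K A) * N_col n m G s \<mu>) i $ j
      = (\<Sum>l<m * n. (1\<^sub>m m \<otimes>\<^sub>K A) $$ (i, l) * N_col n m G s \<mu> $$ (l, j))"
    using i j Nr k by (auto simp: scalar_prod_def atLeast0LessThan)
  also have "\<dots> = (\<Sum>l<m * n. if l div n = i div a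
      then A $$ (i mod a, l mod n) * Nf G (Suc (i div a)) s \<mu> $$ (l mod n, j) else 0)"
    using i j by (intro sum.cong) (auto simp: kron_one_index[OF A] N_col_index[OF reg])
  also have "\<dots> = (\<Sum>u<n. A $$ (i mod a, u) * Nf G (Suc (i div a)) s \<mu> $$ (u, j))"
    by (rule sum_block[OF jd(1)])
  also have "\<dots> = row (A * Nf G (Suc (i div a)) s \<mu>) (i mod a) $ j"
    using j jd N A by (auto simp: scalar_prod_def atLeast0LessThan)
  finally show "row ((1\<^sub>m m \<otimes>\<^sub>K A) * N_col n m G s \<mu>) i $ j
      = row (A * Nf G (Suc (i div a)) s \<mu>) (i mod a) $ j" .
qed

text \<open>Both sides carry the blocks \<open>A * N\<^sub>j * B\<close>, stacked vertically in the hypothesis and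
  horizontally in the conclusion.\<close>

lemma N_row_eq_of_N_col_eq:
  assumes reg: "regular_at n m p G \<mu> s" and A: "A \<in> carrier_mat a n"
    and B: "B \<in> carrier_mat n c" and B': "B' \<in> carrier_mat n c"
    and eq: "(1\<^sub>m m \<otimes>\<^sub>K A) * N_col n m G s \<mu> * B = (1\<^sub>m m \<otimes>\<^sub>K A) * N_col n m G s \<mu> * B'"
  shows "A * (N_row n m G s \<mu> * (1\<^sub>m m \<otimes>\<^sub>K B)) = A * (N_row n m G s \<mu> * (1\<^sub>m m \<otimes>\<^sub>K B'))"
proof -
  let ?R = "N_row n m G s \<mu>" and ?N = "\<lambda>t. Nf G (Suc t) s \<mu>"
  have k: "1\<^sub>m m \<otimes>\<^sub>K A \<in> carrier_mat (m * a) (m * n)" using A by simp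
  note Nc = N_col_carrier[OF reg] and Nr = N_row_carrier[OF reg]
  \<comment> \<open>Row \<open>t * a + i\<close> of the stacked product is row \<open>i\<close> of
    its block \<open>t\<close>, so the hypothesis contains the equality of all blocks.\<close>
  have stacked: "(A * ?N t * X) $$ (i, j) = ((1\<^sub>m m \<otimes>\<^sub>K A) * N_col n m G s \<mu> * X) $$ (t * a + i, j)"
    if "t < m" "i < a" "j < c" "X \<in> carrier_mat n c" for t i j X
  proof -
    have "t * a + i < Suc t * a" using that by simp
    also have "\<dots> \<le> m * a" using that by (intro mult_right_mono) auto
    finally have I: "t * a + i < m * a" .
    have "row ((1\<^sub>m m \<otimes>\<^sub>K A) * N_col n m G s \<mu>) (t * a + i) = row (A * ?N t) i"
      using row_kron_mult_N_col[OF reg A I] that by simp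
    moreover have "((1\<^sub>m m \<otimes>\<^sub>K A) * N_col n m G s \<mu> * X) $$ (t * a + i, j)
        = row ((1\<^sub>m m \<otimes>\<^sub>K A) * N_col n m G s \<mu>) (t * a + i) \<bullet> col X j"
      using I carrier_matD[OF k] that by (intro index_mult_mat(1)) auto
    moreover have "(A * ?N t * X) $$ (i, j) = row (A * ?N t) i \<bullet> col X j"
      using A that by (intro index_mult_mat(1)) auto
    ultimately show ?thesis by simp
  qed
  have blocks: "A * ?N t * B = A * ?N t * B'" if t: "t < m" for t
    using A B B' t by (intro eq_matI) (auto simp: stacked eq simp del: index_mult_mat(1))
  \<comment> \<open>Column \<open>j\<close> of the horizontal arrangement is column
    \<open>j mod c\<close> of block \<open>j div c\<close>, so the block equalities determine every
    entry.\<close>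
  have entry: "(A * (?R * (1\<^sub>m m \<otimes>\<^sub>K X))) $$ (i, j) = (A * ?N (j div c) * X) $$ (i, j mod c)"
    if X: "X \<in> carrier_mat n c" and i: "i < a" and j: "j < m * c" for X i j
  proof -
    note jd = div_less_mult[OF j] mod_less_mult[OF j]
    note N = regular_atD(4)[OF reg jd(1)]
    have "dim_col (1\<^sub>m m \<otimes>\<^sub>K X) = m * c" using X kron_one_carrier by blast
    then have "(A * (?R * (1\<^sub>m m \<otimes>\<^sub>K X))) $$ (i, j) = row A i \<bullet> col (?N (j div c) * X) (j mod c)"
      using A X i j by (simp add: col_N_row_mult_kron[OF reg X j])
    also have "\<dots> = (A * (?N (j div c) * X)) $$ (i, j mod c)"
      using A X i jd by simp
    also have "A * (?N (j div c) * X) = A * ?N (j div c) * X"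
      using A N X by simp
    finally show ?thesis .
  qed
  have "1\<^sub>m m \<otimes>\<^sub>K X \<in> carrier_mat (m * n) (m * c)" if "X \<in> carrier_mat n c" for X
    using that by simp
  note kB = this[OF B] this[OF B']
  have "A * (?R * (1\<^sub>m m \<otimes>\<^sub>K B)) \<in> carrier_mat a (m * c)"
    "A * (?R * (1\<^sub>m m \<otimes>\<^sub>K B')) \<in> carrier_mat a (m * c)"
    using A Nr kB by auto
  then show ?thesis
    using entry[OF B] entry[OF B'] blocks div_less_mult
    by (intro eq_matI) (auto simp del: index_mult_mat)
qed

section \<open>The cascade recursion and its agreement with the Kronecker product formula\<close>

text \<open>\<open>X\<close> is the input of the first listed stage and
  \<open>minv (Kf G s \<mu>) * X\<close> its state. Frequencies are consumed from
  \<open>s\<^sub>1\<close>, whose factors stand at the right end of \<open>transfer\<close>; each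
  stage but the last multiplies the number of columns by \<open>m\<close>.\<close>

fun cascade ::
    "nat \<Rightarrow> nat \<Rightarrow> bilinear_system \<Rightarrow> real vec \<Rightarrow> complex list \<Rightarrow> complex mat \<Rightarrow> complex mat" where
  "cascade n m G \<mu> [] X = X"
| "cascade n m G \<mu> [s] X = Cf G s \<mu> * (minv (Kf G s \<mu>) * X)"
| "cascade n m G \<mu> (s # s' # ss) X =
     cascade n m G \<mu> (s' # ss) (N_row n m G s \<mu> * (1\<^sub>m m \<otimes>\<^sub>K (minv (Kf G s \<mu>) * X)))"

lemma mprod_snoc: "mprod n (As @ [A]) = mprod n As * A"
  by (simp add: mprod_def)

lemma mprod_carrier:
  assumes "\<And>j. 1 \<le> j \<Longrightarrow> j < k \<Longrightarrow> F j \<in> carrier_mat (m ^ (j - 1) * n) (m ^ j * n)" "k \<ge> 1"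
  shows "mprod n (map F [1..<k]) \<in> carrier_mat n (m ^ (k - 1) * n)"
  using assms(2,1)
proof (induction k rule: dec_induct)
  case base
  then show ?case by (simp add: mprod_def)
next
  case (step k)
  then have "F k \<in> carrier_mat (m ^ (k - 1) * n) (m ^ k * n)" by simp
  moreover have "mprod n (map F [1..<k]) \<in> carrier_mat n (m ^ (k - 1) * n)" using step by simp
  ultimately show ?case using step(1) by (auto simp: mprod_snoc)
qed

lemma N_row_kron_carrier:
  assumes "regular_at n m p G \<mu> s" "X \<in> carrier_mat n a"
  shows "N_row n m G s \<mu> * (1\<^sub>m m \<otimes>\<^sub>K X) \<in> carrier_mat n (m * a)"
  using N_row_carrier[OF assms(1)] kron_one_carrier[OF assms(2), of m] by auto

lemma assoc_mult_mat5:
  fixes A B C D E :: "'a::semiring_0 mat"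
  assumes "A \<in> carrier_mat n1 n2" "B \<in> carrier_mat n2 n3" "C \<in> carrier_mat n3 n4"
    "D \<in> carrier_mat n4 n5" "E \<in> carrier_mat n5 n6"
  shows "A * B * (C * (D * E)) = A * (B * (C * D)) * E"
proof -
  have AB: "A * B \<in> carrier_mat n1 n3" and CD: "C * D \<in> carrier_mat n3 n5" using assms by auto
  have "A * B * (C * (D * E)) = A * B * (C * D * E)"
    using assoc_mult_mat[OF assms(3-5)] by simp
  also have "\<dots> = A * B * (C * D) * E" using assoc_mult_mat[OF AB CD assms(5)] by simp
  also have "A * B * (C * D) = A * (B * (C * D))" using assoc_mult_mat[OF assms(1,2) CD] .
  finally show ?thesis .
qed

text \<open>Induction along the list, for arbitrary \<open>X\<close> because each stage changes the
  input. The factors are indexed from the end of the list, so prefixing a stage keeps those already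
  present and appends one at the right.\<close>

lemma cascade_eq_mprod:
  assumes "\<forall>s\<in>set ss. regular_at n m p G \<mu> s" "ss \<noteq> []" "X \<in> carrier_mat n a"
  shows "cascade n m G \<mu> ss X =
    Cf G (last ss) \<mu> * minv (Kf G (last ss) \<mu>)
    * mprod n (map (\<lambda>j. (1\<^sub>m (m ^ (j - 1)) \<otimes>\<^sub>K N_row n m G (ss ! (length ss - j - 1)) \<mu>)
                      * (1\<^sub>m (m ^ j) \<otimes>\<^sub>K minv (Kf G (ss ! (length ss - j - 1)) \<mu>))) [1..<length ss])
    * (1\<^sub>m (m ^ (length ss - 1)) \<otimes>\<^sub>K X)"
  using assms
proof (induction n m G \<mu> ss X arbitrary: a rule: cascade.induct)
  case (2 n m G \<mu> s X)
  then have reg: "regular_at n m p G \<mu> s" by simp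
  note d = regular_atD(1,5)[OF reg]
  \<comment> \<open>For a single stage the product is empty and the identity has size
    \<open>m ^ 0\<close>.\<close>
  have "1\<^sub>m 1 \<otimes>\<^sub>K X = X" using 2(3) by (intro eq_matI) (auto simp: kron_def)
  then show ?case using d 2(3) by (auto simp: mprod_def)
next
  case (3 n m G \<mu> s s' ss X)
  then have reg: "regular_at n m p G \<mu> s" by simp
  define ts where "ts = s' # ss"
  define l where "l = length ss"
  \<comment> \<open>The list is a parameter because the factors for \<open>ts\<close> and for
    \<open>s # ts\<close> are compared.\<close>
  define F where "F = (\<lambda>ss j. (1\<^sub>m (m ^ (j - 1)) \<otimes>\<^sub>K N_row n m G (ss ! (length ss - j - 1)) \<mu>)
                      * (1\<^sub>m (m ^ j) \<otimes>\<^sub>K minv (Kf G (ss ! (length ss - j - 1)) \<mu>)))"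
  let ?K = "minv (Kf G s \<mu>)" and ?N = "N_row n m G s \<mu>"
  let ?L = "Cf G (last ts) \<mu> * minv (Kf G (last ts) \<mu>)"
  let ?P = "mprod n (map (F ts) [1..<Suc l])"
  let ?Y = "?N * (1\<^sub>m m \<otimes>\<^sub>K (?K * X))"
  have len: "length ts = Suc l" by (simp add: ts_def l_def)
  note d = regular_atD(5)[OF reg] N_row_carrier[OF reg] 3(4)
  have KX: "?K * X \<in> carrier_mat n a" using d by auto
  have Y: "?Y \<in> carrier_mat n (m * a)" using N_row_kron_carrier[OF reg KX] .
  have IH: "cascade n m G \<mu> ts ?Y = ?L * ?P * (1\<^sub>m (m ^ l) \<otimes>\<^sub>K ?Y)"
    using 3(1)[OF _ _ Y] 3(2) unfolding ts_def[symmetric] F_def len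
    by (simp add: ts_def del: upt_Suc)
  \<comment> \<open>For \<open>j = Suc l\<close> the position \<open>length (s # ts) - j - 1\<close>
    is 0, which is the new frequency \<open>s\<close>.\<close>
  have last: "F (s # ts) (Suc l) = (1\<^sub>m (m ^ l) \<otimes>\<^sub>K ?N) * (1\<^sub>m (m ^ Suc l) \<otimes>\<^sub>K ?K)"
    by (simp add: F_def len)
  \<comment> \<open>For smaller \<open>j\<close> the increased length and the prefixed element each
    shift the position by one, so the same frequency is selected.\<close>
  have init: "map (F (s # ts)) [1..<Suc l] = map (F ts) [1..<Suc l]"
    by (rule map_cong) (auto simp: F_def len Suc_diff_le nth_Cons split: nat.split)
  have "map (F (s # ts)) [1..<Suc (Suc l)] = map (F ts) [1..<Suc l] @ [F (s # ts) (Suc l)]"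
    unfolding init[symmetric] by simp
  then have P: "mprod n (map (F (s # ts)) [1..<Suc (Suc l)])
      = ?P * ((1\<^sub>m (m ^ l) \<otimes>\<^sub>K ?N) * (1\<^sub>m (m ^ Suc l) \<otimes>\<^sub>K ?K))"
    unfolding last by (simp only: mprod_snoc)
  have "last ts \<in> set ts" by (simp add: ts_def)
  then have "regular_at n m p G \<mu> (last ts)" using 3(2) by (simp add: ts_def)
  from regular_atD(1,5)[OF this] have L: "?L \<in> carrier_mat p n" by auto
  have Fc: "F ts j \<in> carrier_mat (m ^ (j - 1) * n) (m ^ j * n)" if "1 \<le> j" "j < Suc l" for j
  proof -
    have "ts ! (length ts - j - 1) \<in> set ts" using that len by (intro nth_mem) auto
    then have r: "regular_at n m p G \<mu> (ts ! (length ts - j - 1))" using 3(2) unfolding ts_def by auto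
    have e: "m ^ (j - 1) * (m * n) = m ^ j * n" using that by (cases j) auto
    show ?thesis
      using kron_one_carrier[OF N_row_carrier[OF r], of "m ^ (j - 1)"]
        kron_one_carrier[OF regular_atD(5)[OF r], of "m ^ j"]
      unfolding F_def e by (rule mult_carrier_mat)
  qed
  have Pc: "?P \<in> carrier_mat n (m ^ l * n)"
    using mprod_carrier[of "Suc l" "F ts" m n] Fc by simp
  \<comment> \<open>Two uses of the mixed-product rule, with \<open>m ^ l\<close> and the inner
    \<open>m\<close> merged in between, split off the new factor of the product.\<close>
  have kY: "1\<^sub>m (m ^ l) \<otimes>\<^sub>K ?Y
      = (1\<^sub>m (m ^ l) \<otimes>\<^sub>K ?N) * ((1\<^sub>m (m ^ Suc l) \<otimes>\<^sub>K ?K) * (1\<^sub>m (m ^ Suc l) \<otimes>\<^sub>K X))"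
    using kron_one_mult[OF d(2) kron_one_carrier[OF KX, of m], of "m ^ l"]
      kron_one_kron_one[OF KX, of "m ^ l" m] kron_one_mult[OF d(1) d(3), of "m ^ Suc l"]
    by (simp only: power_Suc2)
  have kN: "1\<^sub>m (m ^ l) \<otimes>\<^sub>K ?N \<in> carrier_mat (m ^ l * n) (m ^ Suc l * n)"
    using kron_one_carrier[OF d(2), of "m ^ l"] by (simp only: power_Suc2 mult.assoc)
  have "?L * ?P * (1\<^sub>m (m ^ l) \<otimes>\<^sub>K ?Y)
      = ?L * (?P * ((1\<^sub>m (m ^ l) \<otimes>\<^sub>K ?N) * (1\<^sub>m (m ^ Suc l) \<otimes>\<^sub>K ?K))) * (1\<^sub>m (m ^ Suc l) \<otimes>\<^sub>K X)"
    unfolding kY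
    by (rule assoc_mult_mat5[OF L Pc kN kron_one_carrier[OF d(1)] kron_one_carrier[OF d(3)]])
  then have "cascade n m G \<mu> (s # ts) X
      = ?L * mprod n (map (F (s # ts)) [1..<Suc (Suc l)]) * (1\<^sub>m (m ^ Suc l) \<otimes>\<^sub>K X)"
    unfolding P using IH by (simp add: ts_def)
  then show ?case
    unfolding F_def ts_def[symmetric] using len by (simp add: ts_def)
qed simp

lemma transfer_eq_cascade:
  assumes "\<forall>s\<in>set ss. regular_at n m p G \<mu> s" "ss \<noteq> []"
  shows "transfer n m G ss \<mu> = cascade n m G \<mu> ss (Bf G (hd ss) \<mu>)"
proof -
  have "Bf G (hd ss) \<mu> \<in> carrier_mat n m" using assms regular_atD(3) hd_in_set by metis
  from cascade_eq_mprod[OF assms this] show ?thesis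
    using assms(2) by (simp add: transfer_def Let_def last_conv_nth hd_conv_nth)
qed

section \<open>Projection\<close>

lemma reduced_system_simps [simp]:
  "Cf (reduced_system V W G) s \<mu> = Cf G s \<mu> * V"
  "Kf (reduced_system V W G) s \<mu> = mat_adjoint W * Kf G s \<mu> * V"
  "Bf (reduced_system V W G) s \<mu> = mat_adjoint W * Bf G s \<mu>"
  "Nf (reduced_system V W G) j s \<mu> = mat_adjoint W * Nf G j s \<mu> * V"
  by (simp_all add: reduced_system_def)

lemma regular_at_reduced:
  assumes "regular_at n m p G \<mu> s" "V \<in> carrier_mat n r" "W \<in> carrier_mat n r"
    and "invertible_mat (Kf (reduced_system V W G) s \<mu>)"
  shows "regular_at r m p (reduced_system V W G) \<mu> s"
proof -
  have W': "mat_adjoint W \<in> carrier_mat r n" using assms(3) by simp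
  then have "mat_adjoint W * A * V \<in> carrier_mat r r" if "A \<in> carrier_mat n n" for A
    using that assms(2) by (intro mult_carrier_mat)
  moreover have "mat_adjoint W * A \<in> carrier_mat r m" if "A \<in> carrier_mat n m" for A
    using that W' by (intro mult_carrier_mat)
  moreover have "Cf G s \<mu> * V \<in> carrier_mat p r"
    using regular_atD(1)[OF assms(1)] assms(2) by (intro mult_carrier_mat)
  ultimately show ?thesis using assms(1,4) unfolding regular_at_def by simp
qed

text \<open>Each reduced block is \<open>W\<^sup>H N\<^sub>t V\<close>: \<open>V\<close> is absorbed
  into \<open>Y\<close>, and \<open>W\<^sup>H\<close> comes out of the block row. Hence a reduced
  stage with state \<open>Y\<close> passes on the projection of what a full stage with state
  \<open>V * Y\<close> passes on.\<close>

lemma N_row_reduced_mult: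
  assumes reg: "regular_at n m p G \<mu> s"
    and reg': "regular_at r m p (reduced_system V W G) \<mu> s"
    and V: "V \<in> carrier_mat n r" and W: "W \<in> carrier_mat n r" and Y: "Y \<in> carrier_mat r c"
  shows "N_row r m (reduced_system V W G) s \<mu> * (1\<^sub>m m \<otimes>\<^sub>K Y)
    = mat_adjoint W * (N_row n m G s \<mu> * (1\<^sub>m m \<otimes>\<^sub>K (V * Y)))"
proof (rule eq_matI)
  let ?G = "reduced_system V W G"
  have W': "mat_adjoint W \<in> carrier_mat r n" using W by simp
  have VY: "V * Y \<in> carrier_mat n c" using V Y by auto
  note c1 = N_row_kron_carrier[OF reg' Y] and c2 = N_row_kron_carrier[OF reg VY]
  have c3: "mat_adjoint W * (N_row n m G s \<mu> * (1\<^sub>m m \<otimes>\<^sub>K (V * Y))) \<in> carrier_mat r (m * c)"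
    using W' c2 by (rule mult_carrier_mat)
  show "dim_row (N_row r m ?G s \<mu> * (1\<^sub>m m \<otimes>\<^sub>K Y))
      = dim_row (mat_adjoint W * (N_row n m G s \<mu> * (1\<^sub>m m \<otimes>\<^sub>K (V * Y))))"
    "dim_col (N_row r m ?G s \<mu> * (1\<^sub>m m \<otimes>\<^sub>K Y))
      = dim_col (mat_adjoint W * (N_row n m G s \<mu> * (1\<^sub>m m \<otimes>\<^sub>K (V * Y))))"
    using carrier_matD[OF c1] carrier_matD[OF c3] by simp_all
  fix i j
  assume "i < dim_row (mat_adjoint W * (N_row n m G s \<mu> * (1\<^sub>m m \<otimes>\<^sub>K (V * Y))))"
    and "j < dim_col (mat_adjoint W * (N_row n m G s \<mu> * (1\<^sub>m m \<otimes>\<^sub>K (V * Y))))"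
  then have i: "i < r" and j: "j < m * c" using carrier_matD[OF c3] by simp_all
  note jd = div_less_mult[OF j] mod_less_mult[OF j]
  note N = regular_atD(4)[OF reg jd(1)]
  let ?N = "Nf G (Suc (j div c)) s \<mu>"
  have assoc: "mat_adjoint W * ?N * V * Y = mat_adjoint W * (?N * (V * Y))"
  proof -
    have "mat_adjoint W * ?N * V * Y = mat_adjoint W * ?N * (V * Y)"
      using W' N by (intro assoc_mult_mat[OF _ V Y]) (rule mult_carrier_mat)
    also have "\<dots> = mat_adjoint W * (?N * (V * Y))"
      by (rule assoc_mult_mat[OF W' N VY])
    finally show ?thesis .
  qed
  have "(N_row r m ?G s \<mu> * (1\<^sub>m m \<otimes>\<^sub>K Y)) $$ (i, j)
      = col (N_row r m ?G s \<mu> * (1\<^sub>m m \<otimes>\<^sub>K Y)) j $ i"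
    using carrier_matD[OF c1] i j by (intro index_col[symmetric]) simp_all
  also have "\<dots> = col (mat_adjoint W * (?N * (V * Y))) (j mod c) $ i"
    unfolding col_N_row_mult_kron[OF reg' Y j] reduced_system_simps assoc ..
  also have "\<dots> = row (mat_adjoint W) i \<bullet> col (?N * (V * Y)) (j mod c)"
    using W V Y i jd by simp
  also have "\<dots> = row (mat_adjoint W) i \<bullet> col (N_row n m G s \<mu> * (1\<^sub>m m \<otimes>\<^sub>K (V * Y))) j"
    unfolding col_N_row_mult_kron[OF reg VY j] ..
  also have "\<dots> = (mat_adjoint W * (N_row n m G s \<mu> * (1\<^sub>m m \<otimes>\<^sub>K (V * Y)))) $$ (i, j)"
    using carrier_matD[OF c2] carrier_matD[OF W'] i j by (intro index_mult_mat(1)[symmetric]) simp_all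
  finally show "(N_row r m ?G s \<mu> * (1\<^sub>m m \<otimes>\<^sub>K Y)) $$ (i, j)
      = (mat_adjoint W * (N_row n m G s \<mu> * (1\<^sub>m m \<otimes>\<^sub>K (V * Y)))) $$ (i, j)" .
qed

section \<open>The blocks \<open>V\<^sub>j\<close> as states of the cascade\<close>

lemma V_block_carrier:
  assumes "\<forall>i\<in>{1..j}. regular_at n m p G \<mu> (\<sigma> i)" "1 \<le> j"
  shows "V_block n m G \<sigma> \<mu> j \<in> carrier_mat n (m ^ j)"
  using assms(2,1)
proof (induction j rule: dec_induct)
  case base
  then show ?case using regular_atD(3,5)[of n m p G \<mu> "\<sigma> 1"] by simp
next
  case (step j)
  obtain i where i: "j = Suc i" using step(1) by (cases j) auto
  have "regular_at n m p G \<mu> (\<sigma> j)" "regular_at n m p G \<mu> (\<sigma> (Suc j))" using step by auto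
  note c = regular_atD(5)[OF this(2)] N_row_carrier[OF this(1)]
  have "1\<^sub>m m \<otimes>\<^sub>K V_block n m G \<sigma> \<mu> j \<in> carrier_mat (m * n) (m * m ^ j)"
    using step by (intro kron_one_carrier) auto
  then show ?case unfolding i V_block.simps power_Suc
    using c unfolding i by (intro mult_carrier_mat)
qed

text \<open>Rebracketed so that the right factor is the input which \<open>cascade\<close> hands to
  stage \<open>Suc j\<close>.\<close>

lemma V_block_Suc:
  assumes reg: "\<forall>i\<in>{1..Suc j}. regular_at n m p G \<mu> (\<sigma> i)" and j: "1 \<le> j"
  shows "V_block n m G \<sigma> \<mu> (Suc j) = minv (Kf G (\<sigma> (Suc j)) \<mu>)
    * (N_row n m G (\<sigma> j) \<mu> * (1\<^sub>m m \<otimes>\<^sub>K V_block n m G \<sigma> \<mu> j))"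
proof -
  obtain i where i: "j = Suc i" using j by (cases j) auto
  have r: "regular_at n m p G \<mu> (\<sigma> j)" "regular_at n m p G \<mu> (\<sigma> (Suc j))" using assms by auto
  have "V_block n m G \<sigma> \<mu> j \<in> carrier_mat n (m ^ j)"
    using assms by (intro V_block_carrier[of j n m p]) auto
  from assoc_mult_mat[OF regular_atD(5)[OF r(2)] N_row_carrier[OF r(1)] kron_one_carrier[OF this]]
  show ?thesis unfolding i V_block.simps .
qed

text \<open>In the induction, stage \<open>Suc q\<close> first counts as part of the tail and is
  then absorbed. Since \<open>ts\<close> is nonempty, stage \<open>q\<close> is not the last one and
  hands its state on through \<open>N_row\<close> rather than \<open>Cf\<close>.\<close>

lemma cascade_V_block:
  assumes reg: "\<forall>i\<in>{1..q}. regular_at n m p G \<mu> (\<sigma> i)" and q: "1 \<le> q" and tl: "ts \<noteq> []"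
  shows "cascade n m G \<mu> (map \<sigma> [1..<Suc q] @ ts) (Bf G (\<sigma> 1) \<mu>)
    = cascade n m G \<mu> ts (N_row n m G (\<sigma> q) \<mu> * (1\<^sub>m m \<otimes>\<^sub>K V_block n m G \<sigma> \<mu> q))"
  using q reg tl
proof (induction q arbitrary: ts rule: dec_induct)
  case base
  then obtain t us where "ts = t # us" by (cases ts) auto
  then show ?case by simp
next
  case (step q)
  obtain t us where ts: "ts = t # us" using step.prems by (cases ts) auto
  have "cascade n m G \<mu> (map \<sigma> [1..<Suc (Suc q)] @ ts) (Bf G (\<sigma> 1) \<mu>)
      = cascade n m G \<mu> (map \<sigma> [1..<Suc q] @ (\<sigma> (Suc q) # ts)) (Bf G (\<sigma> 1) \<mu>)"
    by simp
  also have "\<dots> = cascade n m G \<mu> (\<sigma> (Suc q) # ts)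
      (N_row n m G (\<sigma> q) \<mu> * (1\<^sub>m m \<otimes>\<^sub>K V_block n m G \<sigma> \<mu> q))"
    using step.prems by (intro step.IH) auto
  also have "\<dots> = cascade n m G \<mu> ts
      (N_row n m G (\<sigma> (Suc q)) \<mu> * (1\<^sub>m m \<otimes>\<^sub>K V_block n m G \<sigma> \<mu> (Suc q)))"
    unfolding ts cascade.simps using V_block_Suc step by simp
  finally show ?case .
qed

text \<open>The case in which stage \<open>q\<close> is the last one, so that its state passes
  through \<open>Cf\<close>.\<close>

lemma cascade_eq_V_block:
  assumes reg: "\<forall>i\<in>{1..q}. regular_at n m p G \<mu> (\<sigma> i)" and q: "1 \<le> q"
  shows "cascade n m G \<mu> (map \<sigma> [1..<Suc q]) (Bf G (\<sigma> 1) \<mu>)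
    = Cf G (\<sigma> q) \<mu> * V_block n m G \<sigma> \<mu> q"
proof (cases "q = 1")
  case False
  then obtain j where j: "q = Suc j" "1 \<le> j" using q by (cases q) auto
  have "map \<sigma> [1..<Suc q] = map \<sigma> [1..<Suc j] @ [\<sigma> q]" using j by simp
  then have "cascade n m G \<mu> (map \<sigma> [1..<Suc q]) (Bf G (\<sigma> 1) \<mu>)
      = cascade n m G \<mu> [\<sigma> q] (N_row n m G (\<sigma> j) \<mu> * (1\<^sub>m m \<otimes>\<^sub>K V_block n m G \<sigma> \<mu> j))"
    using cascade_V_block[of j n m p G \<mu> \<sigma> "[\<sigma> q]"] reg j by simp
  also have "\<dots> = Cf G (\<sigma> q) \<mu> * V_block n m G \<sigma> \<mu> q"
    unfolding cascade.simps using V_block_Suc[of j n m p G \<mu> \<sigma>] reg j by simp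
  finally show ?thesis .
qed simp

text \<open>If \<open>K\<inverse> U = V X\<close>, then \<open>W\<^sup>H U = W\<^sup>H K V X\<close>, so \<open>X\<close> is the corresponding
  solution of the reduced equation.\<close>

lemma projected_solution:
  assumes reg: "regular_at n m p G \<mu> s" and reg': "regular_at r m p (reduced_system V W G) \<mu> s"
    and V: "V \<in> carrier_mat n r" and W: "W \<in> carrier_mat n r" and U: "U \<in> carrier_mat n c"
    and X: "X \<in> carrier_mat r c" and eq: "minv (Kf G s \<mu>) * U = V * X"
  shows "minv (Kf (reduced_system V W G) s \<mu>) * (mat_adjoint W * U) = X"
proof -
  let ?K = "Kf G s \<mu>" and ?R = "mat_adjoint W * Kf G s \<mu> * V"
  have W': "mat_adjoint W \<in> carrier_mat r n" using W by simp
  note K = regular_atD(2,5,7)[OF reg] and R = regular_atD(2,5,6)[OF reg', unfolded reduced_system_simps]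
  have "U = ?K * minv ?K * U" using U K(3) by simp
  also have "\<dots> = ?K * (V * X)" using assoc_mult_mat[OF K(1,2) U] eq by simp
  also have "\<dots> = ?K * V * X" using assoc_mult_mat[OF K(1) V X] by simp
  finally have "mat_adjoint W * U = mat_adjoint W * (?K * V * X)" by simp
  also have "\<dots> = mat_adjoint W * (?K * V) * X"
    using K(1) V by (intro assoc_mult_mat[symmetric, OF W' _ X]) (rule mult_carrier_mat)
  also have "mat_adjoint W * (?K * V) = ?R" using assoc_mult_mat[OF W' K(1) V] by simp
  finally have "minv ?R * (mat_adjoint W * U) = minv ?R * ?R * X"
    using assoc_mult_mat[OF R(2,1) X] by simp
  also have "\<dots> = X" using R(3) X by simp
  finally show ?thesis by simp
qed

text \<open>Stage by stage: once the lifted reduced state equals the full state, the reduced input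
  of the next stage is \<open>W\<^sup>H\<close> times the full input, and
  \<open>projected_solution\<close> identifies the next reduced state with the coefficient matrix
  \<open>X\<close>.\<close>

lemma V_block_reduced:
  assumes "\<forall>i\<in>{1..j}. regular_at n m p G \<mu> (\<sigma> i)"
    and "\<forall>i\<in>{1..j}. regular_at r m p (reduced_system V W G) \<mu> (\<sigma> i)"
    and V: "V \<in> carrier_mat n r" and W: "W \<in> carrier_mat n r"
    and "\<forall>i\<in>{1..j}. \<exists>X\<in>carrier_mat r (m ^ i). V_block n m G \<sigma> \<mu> i = V * X"
    and "1 \<le> j"
  shows "V * V_block r m (reduced_system V W G) \<sigma> \<mu> j = V_block n m G \<sigma> \<mu> j"
  using assms(6,1,2,5)
proof (induction j rule: dec_induct)
  case base
  then have reg: "regular_at n m p G \<mu> (\<sigma> 1)"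
    and reg': "regular_at r m p (reduced_system V W G) \<mu> (\<sigma> 1)" by auto
  obtain X where X: "X \<in> carrier_mat r m" "minv (Kf G (\<sigma> 1) \<mu>) * Bf G (\<sigma> 1) \<mu> = V * X"
    using base by auto
  show ?case using projected_solution[OF reg reg' V W regular_atD(3)[OF reg] X] X(2) by simp
next
  case (step j)
  let ?G = "reduced_system V W G"
  have r: "regular_at n m p G \<mu> (\<sigma> j)" "regular_at n m p G \<mu> (\<sigma> (Suc j))"
    "regular_at r m p ?G \<mu> (\<sigma> j)" "regular_at r m p ?G \<mu> (\<sigma> (Suc j))"
    using step by auto
  have IH: "V * V_block r m ?G \<sigma> \<mu> j = V_block n m G \<sigma> \<mu> j" using step by simp
  have Vj: "V_block n m G \<sigma> \<mu> j \<in> carrier_mat n (m ^ j)"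
    "V_block r m ?G \<sigma> \<mu> j \<in> carrier_mat r (m ^ j)"
    using step.prems(1,2) step.hyps
    by (auto intro!: V_block_carrier[of j n m p] V_block_carrier[of j r m p])
  obtain X where X: "X \<in> carrier_mat r (m * m ^ j)" "V_block n m G \<sigma> \<mu> (Suc j) = V * X"
    using step.prems(3) by force
  have eq: "V_block n m G \<sigma> \<mu> (Suc j) = minv (Kf G (\<sigma> (Suc j)) \<mu>)
      * (N_row n m G (\<sigma> j) \<mu> * (1\<^sub>m m \<otimes>\<^sub>K V_block n m G \<sigma> \<mu> j))"
    using V_block_Suc step by blast
  have eq': "V_block r m ?G \<sigma> \<mu> (Suc j) = minv (Kf ?G (\<sigma> (Suc j)) \<mu>)
      * (N_row r m ?G (\<sigma> j) \<mu> * (1\<^sub>m m \<otimes>\<^sub>K V_block r m ?G \<sigma> \<mu> j))"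
    using V_block_Suc step by blast
  have "V_block r m ?G \<sigma> \<mu> (Suc j) = X"
    unfolding eq' N_row_reduced_mult[OF r(1,3) V W Vj(2)] IH
    using projected_solution[OF r(2,4) V W N_row_kron_carrier[OF r(1) Vj(1)] X(1)] eq X(2) by simp
  then show ?case using X(2) by simp
qed

section \<open>The blocks \<open>W\<^sub>i\<close> and the last stages of the cascade\<close>

lemma W_block_carrier:
  assumes "\<forall>i\<in>{1..\<theta>}. regular_at n m p G \<mu> (\<tau> i)" "1 \<le> i" "i \<le> \<theta>"
  shows "W_block n m G \<theta> \<tau> \<mu> i \<in> carrier_mat n (m ^ (i - 1) * p)"
  using assms(2,3)
proof (induction i rule: dec_induct)
  case base
  then have "regular_at n m p G \<mu> (\<tau> \<theta>)" using assms by auto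
  from adjoint_carrier[OF regular_atD(5)[OF this]] adjoint_carrier[OF regular_atD(1)[OF this]]
  show ?case by (simp del: adjoint_carrier)
next
  case (step j)
  obtain i where i: "j = Suc i" using step(1) by (cases j) auto
  have "regular_at n m p G \<mu> (\<tau> (\<theta> - Suc (Suc i) + 1))" using step assms i by auto
  note c = adjoint_carrier[OF regular_atD(5)[OF this]] adjoint_carrier[OF N_col_carrier[OF this]]
  have "1\<^sub>m m \<otimes>\<^sub>K W_block n m G \<theta> \<tau> \<mu> j \<in> carrier_mat (m * n) (m * (m ^ (j - 1) * p))"
    using step by (intro kron_one_carrier) auto
  then have "W_block n m G \<theta> \<tau> \<mu> (Suc j) \<in> carrier_mat n (m * (m ^ (j - 1) * p))"
    using c unfolding i W_block.simps by (intro mult_carrier_mat)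
  then show ?case by (simp add: i mult.assoc)
qed

text \<open>Transposition reverses the factors, so that \<open>W\<^sub>i\<^sup>H\<close> can act on
  an input from the left. The new frequency \<open>\<tau> (\<theta> - i)\<close> immediately
  precedes those already covered by \<open>W\<^sub>i\<close>.\<close>

lemma adjoint_W_block_Suc:
  assumes reg: "\<forall>i\<in>{1..\<theta>}. regular_at n m p G \<mu> (\<tau> i)" and i: "1 \<le> i" "Suc i \<le> \<theta>"
  shows "mat_adjoint (W_block n m G \<theta> \<tau> \<mu> (Suc i))
    = (1\<^sub>m m \<otimes>\<^sub>K mat_adjoint (W_block n m G \<theta> \<tau> \<mu> i)) * N_col n m G (\<tau> (\<theta> - i)) \<mu>
      * minv (Kf G (\<tau> (\<theta> - i)) \<mu>)"
proof -
  obtain j where j: "i = Suc j" using i by (cases i) auto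
  have e: "\<theta> - Suc i + 1 = \<theta> - i" using i by simp
  have r: "regular_at n m p G \<mu> (\<tau> (\<theta> - i))" using assms by auto
  let ?K = "minv (Kf G (\<tau> (\<theta> - i)) \<mu>)" and ?N = "N_col n m G (\<tau> (\<theta> - i)) \<mu>"
    and ?W = "W_block n m G \<theta> \<tau> \<mu> i"
  have "?W \<in> carrier_mat n (m ^ (i - 1) * p)" using W_block_carrier assms by simp
  note kW = kron_one_carrier[OF this, of m]
  note K = regular_atD(5)[OF r] and N = N_col_carrier[OF r]
  note K' = adjoint_carrier[OF K] and N' = adjoint_carrier[OF N]
  have "mat_adjoint (mat_adjoint ?K * mat_adjoint ?N * (1\<^sub>m m \<otimes>\<^sub>K ?W))
      = (1\<^sub>m m \<otimes>\<^sub>K mat_adjoint ?W) * mat_adjoint (mat_adjoint ?K * mat_adjoint ?N)"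
    unfolding adjoint_kron_one[symmetric] by (rule adjoint_mult[OF mult_carrier_mat[OF K' N'] kW])
  also have "mat_adjoint (mat_adjoint ?K * mat_adjoint ?N) = ?N * ?K"
    using adjoint_mult[OF K' N'] by simp
  also have "(1\<^sub>m m \<otimes>\<^sub>K mat_adjoint ?W) * (?N * ?K) = (1\<^sub>m m \<otimes>\<^sub>K mat_adjoint ?W) * ?N * ?K"
    using adjoint_carrier[OF kW] unfolding adjoint_kron_one
    by (rule assoc_mult_mat[symmetric, OF _ N K])
  finally show ?thesis unfolding j W_block.simps e[unfolded j] .
qed

text \<open>The bound on \<open>i\<close> keeps the truncated subtraction from hiding the prepended
  frequency.\<close>

lemma tail_Suc:
  assumes "Suc i \<le> \<theta>"
  shows "map \<tau> [\<theta> - Suc i + 1..<Suc \<theta>] = \<tau> (\<theta> - i) # map \<tau> [\<theta> - i + 1..<Suc \<theta>]"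
proof -
  have "\<theta> - Suc i + 1 = \<theta> - i" using assms by simp
  then show ?thesis using assms by (simp add: upt_conv_Cons del: upt_Suc)
qed

text \<open>Induction on the number of stages. The stacked blocks of
  \<open>W\<^sub>i\<^sup>H N\<^sub>t K^-1 X\<close> make up the adjoint of the next \<open>W\<close>
  block applied to \<open>X\<close>; rearranged horizontally they are
  \<open>W\<^sub>i\<^sup>H\<close> applied to the input of the following stage. A congruence avoids
  writing out this rearrangement.\<close>

lemma cascade_W_block_cong:
  assumes reg: "\<forall>i\<in>{1..\<theta>}. regular_at n m p G \<mu> (\<tau> i)" and "1 \<le> i" "i \<le> \<theta>"
    and "X \<in> carrier_mat n c" "X' \<in> carrier_mat n c"
    and "mat_adjoint (W_block n m G \<theta> \<tau> \<mu> i) * X = mat_adjoint (W_block n m G \<theta> \<tau> \<mu> i) * X'"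
  shows "cascade n m G \<mu> (map \<tau> [\<theta> - i + 1..<Suc \<theta>]) X
    = cascade n m G \<mu> (map \<tau> [\<theta> - i + 1..<Suc \<theta>]) X'"
  using assms(2-6)
proof (induction i arbitrary: X X' c rule: dec_induct)
  case base
  have r: "regular_at n m p G \<mu> (\<tau> \<theta>)" using reg base by auto
  note C = regular_atD(1)[OF r] and K = regular_atD(5)[OF r]
  have "mat_adjoint (W_block n m G \<theta> \<tau> \<mu> 1) = Cf G (\<tau> \<theta>) \<mu> * minv (Kf G (\<tau> \<theta>) \<mu>)"
    using adjoint_mult[OF adjoint_carrier[OF K] adjoint_carrier[OF C]] by simp
  then have "Cf G (\<tau> \<theta>) \<mu> * minv (Kf G (\<tau> \<theta>) \<mu>) * X = Cf G (\<tau> \<theta>) \<mu> * minv (Kf G (\<tau> \<theta>) \<mu>) * X'"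
    using base by simp
  moreover have "[\<theta> - 1 + 1..<Suc \<theta>] = [\<theta>]" using base by simp
  ultimately show ?case
    using assoc_mult_mat[OF C K base(2)] assoc_mult_mat[OF C K base(3)] by simp
next
  case (step i)
  let ?s = "\<tau> (\<theta> - i)" and ?Wi = "W_block n m G \<theta> \<tau> \<mu> i" and ?ts = "map \<tau> [\<theta> - i + 1..<Suc \<theta>]"
  have r: "regular_at n m p G \<mu> ?s" using reg step by auto
  let ?K = "minv (Kf G ?s \<mu>)" and ?N = "N_row n m G ?s \<mu>"
  note K = regular_atD(5)[OF r]
  have KX: "?K * X \<in> carrier_mat n c" "?K * X' \<in> carrier_mat n c" using K step.prems by auto
  have "?Wi \<in> carrier_mat n (m ^ (i - 1) * p)" using W_block_carrier reg step by simp
  note W = adjoint_carrier[OF this]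
  have kWN: "(1\<^sub>m m \<otimes>\<^sub>K mat_adjoint ?Wi) * N_col n m G ?s \<mu> \<in> carrier_mat (m * (m ^ (i - 1) * p)) n"
    using kron_one_carrier[OF W] N_col_carrier[OF r] by (rule mult_carrier_mat)
  have "(1\<^sub>m m \<otimes>\<^sub>K mat_adjoint ?Wi) * N_col n m G ?s \<mu> * (?K * X)
      = (1\<^sub>m m \<otimes>\<^sub>K mat_adjoint ?Wi) * N_col n m G ?s \<mu> * (?K * X')"
    using step.prems(4) unfolding adjoint_W_block_Suc[OF reg step(1) step.prems(1)]
      assoc_mult_mat[OF kWN K step.prems(2)] assoc_mult_mat[OF kWN K step.prems(3)] .
  \<comment> \<open>Passage from the block column, in which \<open>W_block\<close> is built, to the
    block row, in which \<open>cascade\<close> passes inputs on.\<close>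
  then have "mat_adjoint ?Wi * (?N * (1\<^sub>m m \<otimes>\<^sub>K (?K * X)))
      = mat_adjoint ?Wi * (?N * (1\<^sub>m m \<otimes>\<^sub>K (?K * X')))"
    by (rule N_row_eq_of_N_col_eq[OF r W KX])
  then have "cascade n m G \<mu> ?ts (?N * (1\<^sub>m m \<otimes>\<^sub>K (?K * X)))
      = cascade n m G \<mu> ?ts (?N * (1\<^sub>m m \<otimes>\<^sub>K (?K * X')))"
    using step.prems(1)
    by (intro step.IH[OF _ N_row_kron_carrier[OF r KX(1)] N_row_kron_carrier[OF r KX(2)]]) auto
  moreover obtain t us where "?ts = t # us" using step.hyps step.prems(1) by (cases ?ts) (auto split: if_splits)
  ultimately show ?case unfolding tail_Suc[OF step.prems(1)] by simp
qed

text \<open>The input \<open>K V Y\<close>, with \<open>Y\<close> the reduced state belonging to \<open>X\<close>, is indistinguishable from \<open>X\<close>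
  by functionals in the range of \<open>W\<close>, while its full state \<open>V Y\<close> is the lifted reduced state.\<close>

lemma galerkin_input:
  fixes G V W \<mu> s X
  defines "Y \<equiv> minv (Kf (reduced_system V W G) s \<mu>) * (mat_adjoint W * X)"
  assumes reg: "regular_at n m p G \<mu> s" and reg': "regular_at r m p (reduced_system V W G) \<mu> s"
    and V: "V \<in> carrier_mat n r" and W: "W \<in> carrier_mat n r" and X: "X \<in> carrier_mat n c"
  shows "Y \<in> carrier_mat r c" "Kf G s \<mu> * (V * Y) \<in> carrier_mat n c"
    "minv (Kf G s \<mu>) * (Kf G s \<mu> * (V * Y)) = V * Y"
    "Z \<in> carrier_mat r d \<Longrightarrow>
      mat_adjoint (W * Z) * X = mat_adjoint (W * Z) * (Kf G s \<mu> * (V * Y))"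
proof -
  let ?K = "Kf G s \<mu>" and ?R = "mat_adjoint W * Kf G s \<mu> * V"
  have W': "mat_adjoint W \<in> carrier_mat r n" using W by simp
  have WX: "mat_adjoint W * X \<in> carrier_mat r c" using W' X by (rule mult_carrier_mat)
  note K = regular_atD(2,5,6)[OF reg] and R = regular_atD(2,5,7)[OF reg', unfolded reduced_system_simps]
  have Y_eq: "Y = minv ?R * (mat_adjoint W * X)" by (simp add: Y_def)
  show Y: "Y \<in> carrier_mat r c" unfolding Y_eq using R(2) WX by (rule mult_carrier_mat)
  have VY: "V * Y \<in> carrier_mat n c" using V Y by (rule mult_carrier_mat)
  show KVY: "?K * (V * Y) \<in> carrier_mat n c" using K(1) VY by (rule mult_carrier_mat)
  show "minv ?K * (?K * (V * Y)) = V * Y"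
    using assoc_mult_mat[OF K(2,1) VY] unfolding K(3) left_mult_one_mat[OF VY] by (rule sym)
  have "mat_adjoint W * (?K * (V * Y)) = mat_adjoint W * ?K * (V * Y)"
    by (rule assoc_mult_mat[symmetric, OF W' K(1) VY])
  also have "\<dots> = ?R * Y"
    by (rule assoc_mult_mat[symmetric, OF mult_carrier_mat[OF W' K(1)] V Y])
  also have "\<dots> = ?R * minv ?R * (mat_adjoint W * X)"
    unfolding Y_eq by (rule assoc_mult_mat[symmetric, OF R(1,2) WX])
  also have "\<dots> = mat_adjoint W * X" unfolding R(3) by (rule left_mult_one_mat[OF WX])
  finally have WKVY: "mat_adjoint W * (?K * (V * Y)) = mat_adjoint W * X" .
  assume "Z \<in> carrier_mat r d"
  then have Z': "mat_adjoint Z \<in> carrier_mat d r" by simp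
  have "mat_adjoint (W * Z) = mat_adjoint Z * mat_adjoint W"
    using \<open>Z \<in> carrier_mat r d\<close> by (rule adjoint_mult[OF W])
  then show "mat_adjoint (W * Z) * X = mat_adjoint (W * Z) * (?K * (V * Y))"
    using assoc_mult_mat[OF Z' W' X] assoc_mult_mat[OF Z' W' KVY] WKVY by simp
qed

text \<open>At each stage the input is exchanged for one whose full state is the lifted reduced
  state \<open>V * Y\<close>. The input passed on then projects to the one passed on by the reduced
  stage, and the remaining stages follow by induction.\<close>

lemma cascade_reduced:
  assumes reg: "\<forall>i\<in>{1..\<theta>}. regular_at n m p G \<mu> (\<tau> i)"
    and reg': "\<forall>i\<in>{1..\<theta>}. regular_at r m p (reduced_system V W G) \<mu> (\<tau> i)"
    and V: "V \<in> carrier_mat n r" and W: "W \<in> carrier_mat n r"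
    and Z: "\<forall>i\<in>{1..\<theta>}. \<exists>Z\<in>carrier_mat r (m ^ (i - 1) * p). W_block n m G \<theta> \<tau> \<mu> i = W * Z"
    and "1 \<le> i" "i \<le> \<theta>" "X \<in> carrier_mat n c"
  shows "cascade n m G \<mu> (map \<tau> [\<theta> - i + 1..<Suc \<theta>]) X
    = cascade r m (reduced_system V W G) \<mu> (map \<tau> [\<theta> - i + 1..<Suc \<theta>]) (mat_adjoint W * X)"
  using assms(6-8)
proof (induction i arbitrary: X c rule: dec_induct)
  case base
  have r: "regular_at n m p G \<mu> (\<tau> \<theta>)" "regular_at r m p (reduced_system V W G) \<mu> (\<tau> \<theta>)"
    using reg reg' base by auto
  let ?G = "reduced_system V W G" and ?K = "Kf G (\<tau> \<theta>) \<mu>"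
  let ?Y = "minv (Kf ?G (\<tau> \<theta>) \<mu>) * (mat_adjoint W * X)"
  note Y = galerkin_input[OF r V W base(2)]
  have single: "[\<theta> - 1 + 1..<Suc \<theta>] = [\<theta>]" using base by simp
  have "1 \<in> {1..\<theta>}" using base by simp
  from bspec[OF Z this] obtain Z'
    where "Z' \<in> carrier_mat r (m ^ (1 - 1) * p)" "W_block n m G \<theta> \<tau> \<mu> 1 = W * Z'" ..
  note Z' = this(2) Y(4)[OF this(1)]
  have "mat_adjoint (W_block n m G \<theta> \<tau> \<mu> 1) * X = mat_adjoint (W_block n m G \<theta> \<tau> \<mu> 1) * (?K * (V * ?Y))"
    using Z' by simp
  then have "cascade n m G \<mu> [\<tau> \<theta>] X = cascade n m G \<mu> [\<tau> \<theta>] (?K * (V * ?Y))"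
    using cascade_W_block_cong[OF reg _ _ base(2) Y(2), of 1] base(1) unfolding single by simp
  also have "\<dots> = Cf G (\<tau> \<theta>) \<mu> * (V * ?Y)" by (simp only: cascade.simps Y(3))
  also have "\<dots> = cascade r m ?G \<mu> [\<tau> \<theta>] (mat_adjoint W * X)"
    using assoc_mult_mat[OF regular_atD(1)[OF r(1)] V Y(1)] by simp
  finally show ?case unfolding single by simp
next
  case (step i)
  let ?s = "\<tau> (\<theta> - i)" and ?ts = "map \<tau> [\<theta> - i + 1..<Suc \<theta>]"
  let ?G = "reduced_system V W G" and ?K = "Kf G ?s \<mu>"
  let ?Y = "minv (Kf ?G ?s \<mu>) * (mat_adjoint W * X)"
  have r: "regular_at n m p G \<mu> ?s" "regular_at r m p ?G \<mu> ?s" using reg reg' step by auto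
  note Y = galerkin_input[OF r V W step.prems(2)]
  have VY: "V * ?Y \<in> carrier_mat n c" using V Y(1) by (rule mult_carrier_mat)
  obtain t us where ts: "?ts = t # us" using step.hyps step.prems(1) by (cases ?ts) (auto split: if_splits)
  have "Suc i \<in> {1..\<theta>}" using step.prems(1) by simp
  from bspec[OF Z this] obtain Z' where Z': "Z' \<in> carrier_mat r (m ^ (Suc i - 1) * p)"
    "W_block n m G \<theta> \<tau> \<mu> (Suc i) = W * Z'" ..
  \<comment> \<open>The factorization of the block through \<open>W\<close> makes the two inputs
    agree under its adjoint, so all remaining stages give the same output.\<close>
  have "cascade n m G \<mu> (?s # ?ts) X = cascade n m G \<mu> (?s # ?ts) (?K * (V * ?Y))"
    unfolding tail_Suc[OF step.prems(1), symmetric]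
    using step.prems(1) Y(4)[OF Z'(1)] unfolding Z'(2)[symmetric]
    by (intro cascade_W_block_cong[OF reg _ _ step.prems(2) Y(2)]) simp_all
  also have "\<dots> = cascade n m G \<mu> ?ts (N_row n m G ?s \<mu> * (1\<^sub>m m \<otimes>\<^sub>K (V * ?Y)))"
    unfolding ts cascade.simps Y(3) ..
  also have "\<dots> = cascade r m ?G \<mu> ?ts
      (mat_adjoint W * (N_row n m G ?s \<mu> * (1\<^sub>m m \<otimes>\<^sub>K (V * ?Y))))"
    using step.prems(1) by (intro step.IH[OF _ N_row_kron_carrier[OF r(1) VY]]) simp
  also have "\<dots> = cascade r m ?G \<mu> (?s # ?ts) (mat_adjoint W * X)"
    unfolding N_row_reduced_mult[OF r V W Y(1), symmetric] ts cascade.simps ..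
  finally show ?case unfolding tail_Suc[OF step.prems(1)] .
qed

section \<open>Interpolation of the subsystem transfer functions\<close>

theorem theorem1:
  fixes n m p d r k \<theta> :: nat
    and M :: "real vec set"
    and G :: bilinear_system
    and V W :: "complex mat"
    and \<sigma> \<tau> :: "nat \<Rightarrow> complex"
    and \<mu> :: "real vec"
  assumes "n \<ge> 1" "m \<ge> 1" "p \<ge> 1" "d \<ge> 1" "r \<ge> 1"
    and "M \<subseteq> carrier_vec d"
    and "parametric_bilinear_system n m p M G"
    and "V \<in> carrier_mat n r" "W \<in> carrier_mat n r"
    and "k \<ge> 1" "\<theta> \<ge> 1"
    and "\<mu> \<in> M"
    and "\<forall>s \<in> \<sigma> ` {1..k} \<union> \<tau> ` {1..\<theta>}.
           invertible_mat (Kf G s \<mu>) \<and> invertible_mat (Kf (reduced_system V W G) s \<mu>)"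
  shows "(column_space n (hconcat n (map (V_block n m G \<sigma> \<mu>) [1..<Suc k])) \<subseteq> column_space n V \<longrightarrow>
           (\<forall>j\<in>{1..k}.
              transfer n m G (map \<sigma> [1..<Suc j]) \<mu>
              = transfer r m (reduced_system V W G) (map \<sigma> [1..<Suc j]) \<mu>))
       \<and> (column_space n (hconcat n (map (W_block n m G \<theta> \<tau> \<mu>) [1..<Suc \<theta>])) \<subseteq> column_space n W \<longrightarrow>
           (\<forall>i\<in>{1..\<theta>}.
              transfer n m G (map \<tau> [\<theta> - i + 1..<Suc \<theta>]) \<mu>
              = transfer r m (reduced_system V W G) (map \<tau> [\<theta> - i + 1..<Suc \<theta>]) \<mu>))
       \<and> (column_space n (hconcat n (map (V_block n m G \<sigma> \<mu>) [1..<Suc k])) \<subseteq> column_space n V \<and>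
          column_space n (hconcat n (map (W_block n m G \<theta> \<tau> \<mu>) [1..<Suc \<theta>])) \<subseteq> column_space n W \<longrightarrow>
           (\<forall>q\<in>{1..k}. \<forall>\<eta>\<in>{1..\<theta>}.
              transfer n m G (map \<sigma> [1..<Suc q] @ map \<tau> [\<theta> - \<eta> + 1..<Suc \<theta>]) \<mu>
              = transfer r m (reduced_system V W G)
                  (map \<sigma> [1..<Suc q] @ map \<tau> [\<theta> - \<eta> + 1..<Suc \<theta>]) \<mu>))"
proof -
  let ?G = "reduced_system V W G"
  have reg0: "regular_at n m p G \<mu> s" if "s \<in> \<sigma> ` {1..k} \<union> \<tau> ` {1..\<theta>}" for s
    using assms(7,12,13) that unfolding parametric_bilinear_system_def regular_at_def by blast
  have reg0': "regular_at r m p ?G \<mu> s" if "s \<in> \<sigma> ` {1..k} \<union> \<tau> ` {1..\<theta>}" for s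
    using regular_at_reduced[OF reg0[OF that] assms(8,9)] assms(13) that by blast
  have \<sigma>: "\<forall>i\<in>{1..k}. regular_at n m p G \<mu> (\<sigma> i)" "\<forall>i\<in>{1..k}. regular_at r m p ?G \<mu> (\<sigma> i)"
    and \<tau>: "\<forall>i\<in>{1..\<theta>}. regular_at n m p G \<mu> (\<tau> i)" "\<forall>i\<in>{1..\<theta>}. regular_at r m p ?G \<mu> (\<tau> i)"
    using reg0 reg0' by auto
  \<comment> \<open>The span condition on \<open>V\<close> becomes the statement that the reduced
    states lift to the full ones.\<close>
  have Vs: "V * V_block r m ?G \<sigma> \<mu> j = V_block n m G \<sigma> \<mu> j"
    if sub: "column_space n (hconcat n (map (V_block n m G \<sigma> \<mu>) [1..<Suc k])) \<subseteq> column_space n V"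
      and j: "j \<in> {1..k}" for j
  proof -
    have c: "V_block n m G \<sigma> \<mu> i \<in> carrier_mat n (m ^ i)" if "i \<in> {1..k}" for i
      using \<sigma>(1) that by (intro V_block_carrier[of i n m p]) auto
    have dims: "\<forall>A\<in>set (map (V_block n m G \<sigma> \<mu>) [1..<Suc k]). dim_row A = n"
      using carrier_matD(1)[OF c] by (auto simp del: upt_Suc)
    have mem: "V_block n m G \<sigma> \<mu> i \<in> set (map (V_block n m G \<sigma> \<mu>) [1..<Suc k])" if "i \<in> {1..k}" for i
      using that by (auto simp del: upt_Suc)
    have "\<exists>X\<in>carrier_mat r (m ^ i). V_block n m G \<sigma> \<mu> i = V * X" if i: "i \<in> {1..k}" for i
      using col_space_subset_factor[OF sub dims mem[OF i] assms(8)] carrier_matD(2)[OF c[OF i]] by metis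
    then show ?thesis using \<sigma> j by (intro V_block_reduced[OF _ _ assms(8,9)]) auto
  qed
  have Ws: "\<forall>i\<in>{1..\<theta>}. \<exists>Z\<in>carrier_mat r (m ^ (i - 1) * p). W_block n m G \<theta> \<tau> \<mu> i = W * Z"
    if sub: "column_space n (hconcat n (map (W_block n m G \<theta> \<tau> \<mu>) [1..<Suc \<theta>])) \<subseteq> column_space n W"
  proof
    have c: "W_block n m G \<theta> \<tau> \<mu> i \<in> carrier_mat n (m ^ (i - 1) * p)" if "i \<in> {1..\<theta>}" for i
      using \<tau>(1) that by (intro W_block_carrier) auto
    have dims: "\<forall>A\<in>set (map (W_block n m G \<theta> \<tau> \<mu>) [1..<Suc \<theta>]). dim_row A = n"
      using carrier_matD(1)[OF c] by (auto simp del: upt_Suc)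
    have mem: "W_block n m G \<theta> \<tau> \<mu> i \<in> set (map (W_block n m G \<theta> \<tau> \<mu>) [1..<Suc \<theta>])" if "i \<in> {1..\<theta>}" for i
      using that by (auto simp del: upt_Suc)
    fix i assume i: "i \<in> {1..\<theta>}"
    show "\<exists>Z\<in>carrier_mat r (m ^ (i - 1) * p). W_block n m G \<theta> \<tau> \<mu> i = W * Z"
      using col_space_subset_factor[OF sub dims mem[OF i] assms(9)] carrier_matD(2)[OF c[OF i]] by metis
  qed
  have tail: "map \<tau> [\<theta> - i + 1..<Suc \<theta>] \<noteq> []" "set (map \<tau> [\<theta> - i + 1..<Suc \<theta>]) \<subseteq> \<tau> ` {1..\<theta>}"
    if "i \<in> {1..\<theta>}" for i
    using that by auto
  have init: "map \<sigma> [1..<Suc q] \<noteq> []" "hd (map \<sigma> [1..<Suc q]) = \<sigma> 1"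
    "set (map \<sigma> [1..<Suc q]) \<subseteq> \<sigma> ` {1..k}" if "q \<in> {1..k}" for q
    using that by (auto simp: hd_map upt_conv_Cons simp del: upt_Suc)
  \<comment> \<open>The reduced input matrix is displayed as \<open>W\<^sup>H\<close> times the full
    one, the form in which \<open>cascade_reduced\<close> produces it.\<close>
  have transfers: "transfer n m G ss \<mu> = cascade n m G \<mu> ss (Bf G (hd ss) \<mu>)"
    "transfer r m ?G ss \<mu> = cascade r m ?G \<mu> ss (mat_adjoint W * Bf G (hd ss) \<mu>)"
    if "set ss \<subseteq> \<sigma> ` {1..k} \<union> \<tau> ` {1..\<theta>}" "ss \<noteq> []" for ss
  proof -
    have "\<forall>s\<in>set ss. regular_at n m p G \<mu> s" "\<forall>s\<in>set ss. regular_at r m p ?G \<mu> s"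
      by (intro ballI reg0 reg0' subsetD[OF that(1)]; assumption)+
    from this[THEN transfer_eq_cascade, OF that(2)]
    show "transfer n m G ss \<mu> = cascade n m G \<mu> ss (Bf G (hd ss) \<mu>)"
      "transfer r m ?G ss \<mu> = cascade r m ?G \<mu> ss (mat_adjoint W * Bf G (hd ss) \<mu>)"
      by simp_all
  qed
  show ?thesis
  proof (intro conjI impI ballI)
    \<comment> \<open>Part (a): both transfer functions are the output matrix applied to the last
      state, and \<open>V\<close> moves from the state to \<open>Cf\<close>.\<close>
    fix j
    assume sub: "column_space n (hconcat n (map (V_block n m G \<sigma> \<mu>) [1..<Suc k])) \<subseteq> column_space n V"
      and j: "j \<in> {1..k}"
    have ss: "set (map \<sigma> [1..<Suc j]) \<subseteq> \<sigma> ` {1..k} \<union> \<tau> ` {1..\<theta>}" using init(3)[OF j] by blast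
    have j': "\<forall>i\<in>{1..j}. regular_at n m p G \<mu> (\<sigma> i)" "\<forall>i\<in>{1..j}. regular_at r m p ?G \<mu> (\<sigma> i)" "1 \<le> j"
      "regular_at n m p G \<mu> (\<sigma> j)"
      using \<sigma> j by auto
    have "transfer n m G (map \<sigma> [1..<Suc j]) \<mu> = Cf G (\<sigma> j) \<mu> * (V * V_block r m ?G \<sigma> \<mu> j)"
      unfolding transfers(1)[OF ss init(1)[OF j]] init(2)[OF j] cascade_eq_V_block[OF j'(1,3)]
        Vs[OF sub j] ..
    also have "\<dots> = Cf ?G (\<sigma> j) \<mu> * V_block r m ?G \<sigma> \<mu> j"
      using assoc_mult_mat[OF regular_atD(1)[OF j'(4)] assms(8) V_block_carrier[OF j'(2,3)]] by simp
    also have "\<dots> = transfer r m ?G (map \<sigma> [1..<Suc j]) \<mu>"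
      unfolding transfers(2)[OF ss init(1)[OF j]] init(2)[OF j]
      using cascade_eq_V_block[OF j'(2,3)] by simp
    finally show "transfer n m G (map \<sigma> [1..<Suc j]) \<mu> = transfer r m ?G (map \<sigma> [1..<Suc j]) \<mu>" .
  next
    fix i
    assume sub: "column_space n (hconcat n (map (W_block n m G \<theta> \<tau> \<mu>) [1..<Suc \<theta>])) \<subseteq> column_space n W"
      and i: "i \<in> {1..\<theta>}"
    let ?ts = "map \<tau> [\<theta> - i + 1..<Suc \<theta>]"
    have ss: "set ?ts \<subseteq> \<sigma> ` {1..k} \<union> \<tau> ` {1..\<theta>}" using tail(2)[OF i] by blast
    \<comment> \<open>Part (b): the input matrix at the first frequency of the tail serves as the
      input \<open>X\<close> of \<open>cascade_reduced\<close>.\<close>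
    have "Bf G (hd ?ts) \<mu> \<in> carrier_mat n m"
      using reg0 hd_in_set[OF tail(1)[OF i]] ss by (intro regular_atD(3)) blast
    then show "transfer n m G ?ts \<mu> = transfer r m ?G ?ts \<mu>"
      unfolding transfers[OF ss tail(1)[OF i]]
      using i by (intro cascade_reduced[OF \<tau> assms(8,9) Ws[OF sub]]) auto
  next
    fix q \<eta>
    assume "column_space n (hconcat n (map (V_block n m G \<sigma> \<mu>) [1..<Suc k])) \<subseteq> column_space n V \<and>
        column_space n (hconcat n (map (W_block n m G \<theta> \<tau> \<mu>) [1..<Suc \<theta>])) \<subseteq> column_space n W"
      and q: "q \<in> {1..k}" and \<eta>: "\<eta> \<in> {1..\<theta>}"
    then have subV: "column_space n (hconcat n (map (V_block n m G \<sigma> \<mu>) [1..<Suc k])) \<subseteq> column_space n V"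
      and subW: "column_space n (hconcat n (map (W_block n m G \<theta> \<tau> \<mu>) [1..<Suc \<theta>])) \<subseteq> column_space n W"
      by auto
    let ?ts = "map \<tau> [\<theta> - \<eta> + 1..<Suc \<theta>]"
    have ss: "set (map \<sigma> [1..<Suc q] @ ?ts) \<subseteq> \<sigma> ` {1..k} \<union> \<tau> ` {1..\<theta>}"
      using init(3)[OF q] tail(2)[OF \<eta>] by (simp only: set_append) blast
    have ne: "map \<sigma> [1..<Suc q] @ ?ts \<noteq> []" using init(1)[OF q] by blast
    have hd: "hd (map \<sigma> [1..<Suc q] @ ?ts) = \<sigma> 1"
      unfolding hd_append2[OF init(1)[OF q]] by (rule init(2)[OF q])
    have q': "\<forall>i\<in>{1..q}. regular_at n m p G \<mu> (\<sigma> i)" "\<forall>i\<in>{1..q}. regular_at r m p ?G \<mu> (\<sigma> i)" "1 \<le> q"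
      "regular_at n m p G \<mu> (\<sigma> q)" "regular_at r m p ?G \<mu> (\<sigma> q)"
      using \<sigma> q by auto
    \<comment> \<open>Part (c): \<open>?U\<close> is the input that the \<sigma>-stages hand to the
      first \<tau>-stage. The condition on \<open>W\<close> reduces the \<tau>-stages acting on it,
      and the condition on \<open>V\<close> identifies its projection with the input produced by the
      reduced \<sigma>-stages.\<close>
    let ?U = "N_row n m G (\<sigma> q) \<mu> * (1\<^sub>m m \<otimes>\<^sub>K V_block n m G \<sigma> \<mu> q)"
    have "transfer n m G (map \<sigma> [1..<Suc q] @ ?ts) \<mu> = cascade n m G \<mu> ?ts ?U"
      unfolding transfers(1)[OF ss ne] hd by (rule cascade_V_block[OF q'(1,3) tail(1)[OF \<eta>]])
    also have "\<dots> = cascade r m ?G \<mu> ?ts (mat_adjoint W * ?U)"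
      using \<eta> N_row_kron_carrier[OF q'(4) V_block_carrier[OF q'(1,3)]]
      by (intro cascade_reduced[OF \<tau> assms(8,9) Ws[OF subW]]) auto
    also have "mat_adjoint W * ?U
        = N_row r m ?G (\<sigma> q) \<mu> * (1\<^sub>m m \<otimes>\<^sub>K V_block r m ?G \<sigma> \<mu> q)"
      unfolding N_row_reduced_mult[OF q'(4,5) assms(8,9) V_block_carrier[OF q'(2,3)]] Vs[OF subV q] ..
    also have "cascade r m ?G \<mu> ?ts \<dots> = transfer r m ?G (map \<sigma> [1..<Suc q] @ ?ts) \<mu>"
      unfolding transfers(2)[OF ss ne] hd
      using cascade_V_block[OF q'(2,3) tail(1)[OF \<eta>]] by simp
    finally show "transfer n m G (map \<sigma> [1..<Suc q] @ ?ts) \<mu>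
        = transfer r m ?G (map \<sigma> [1..<Suc q] @ ?ts) \<mu>" .
  qed
qed

end
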